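(* Let $\mathcal{G}$ be a groupoid and $\mathcal{H}$ a wide subgroupoid of $\mathcal{G}$. Then: 1. $\mathcal{I}(\mathcal{G})$ is a normal subgroupoid of $\mathcal{A}(\mathcal{G})$. 2. $\mathcal{I}(\mathrm{Iso}(\mathcal{G}))=\{\mathcal{I}_e\mid e\in\mathcal{G}_0\}$ if and only if $\mathcal{G}$ is an abelian groupoid. 3. The function $\Theta:\mathcal{G}\to\mathcal{I}(\mathcal{G})$ defined by $\Theta(g)=\mathcal{I}_g$ for all $g\in\mathcal{G}$ is a strong homomorphism. 4. The groupoids $\mathcal{G}/\mathcal{Z}(\mathcal{G})$ and $\mathcal{I}(\mathcal{G})$ are isomorphic. 5. $\mathcal{H}$ is normal in $\mathcal{G}$ if and only if it is invariant by all the partial inner isomorphisms of $\mathcal{G}$.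
   Context: Groupoids are taken in the algebraic sense. Let $\mathcal{G}$ be a set with a partial binary operation written as concatenation; $\exists gh$ means that the product $gh$ is defined. An element $e\in\mathcal{G}$ is an identity if $\exists eg$ implies $eg=g$ and $\exists g'e$ implies $g'e=g'$; $\mathcal{G}_0$ is the set of identities. $\mathcal{G}$ is a groupoid if: (1) $\exists g(hl)$ iff $\exists (gh)l$, and then $g(hl)=(gh)l$; (2) $\exists g(hl)$ iff $\exists gh$ and $\exists hl$; (3) for each $g$ there are unique $d(g),r(g)\in\mathcal{G}$ with $\exists g\,d(g)$, $\exists r(g)\,g$ and $g\,d(g)=g=r(g)\,g$; (4) for each $g$ there is $g^{-1}\in\mathcal{G}$ with $d(g)=g^{-1}g$ and $r(g)=gg^{-1}$. (Equivalently, $\mathcal{G}$ is the set of morphisms of a small category in which every morphism is invertible; $\exists gh$ iff $d(g)=r(h)$, and $\mathcal{G}_0=\{d(g)\mid g\in\mathcal{G}\}$.) For $e\in\mathcal{G}_0$, $\mathcal{G}_e=\{g\in\mathcal{G}\mid d(g)=r(g)=e\}$ is the isotropy group at $e$ (a group with identity $e$), and $\mathrm{Iso}(\mathcal{G})=\bigcup_{e\in\mathcal{G}_0}\mathcal{G}_e$, which is a subgroupoid of $\mathcal{G}$. $\mathcal{G}$ is abelian if all its isotropy groups are abelian. The center of $\mathcal{G}$ is $\mathcal{Z}(\mathcal{G})=\{g\in\mathrm{Iso}(\mathcal{G})\mid gh=hg\text{ for all }h\in\mathcal{G}\text{ such that }d(g)=r(h)=d(h)\}$. A nonempty subset $\mathcal{H}\subseteq\mathcal{G}$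 is a subgroupoid of $\mathcal{G}$ if for all $g,h\in\mathcal{H}$: $g^{-1}\in\mathcal{H}$, and $\exists gh$ implies $gh\in\mathcal{H}$. It is wide if $\mathcal{H}_0=\mathcal{G}_0$, equivalently $\mathcal{G}_0\subseteq\mathcal{H}$. For a wide subgroupoid $\mathcal{H}$ and $g\in\mathcal{G}$, $g^{-1}\mathcal{H}g=\{g^{-1}hg\mid h\in\mathcal{H},\ r(h)=d(h)=r(g)\}$. A subgroupoid $\mathcal{H}$ of $\mathcal{G}$ is normal if it is wide and $g^{-1}\mathcal{H}g\subseteq\mathcal{H}$ for all $g\in\mathcal{G}$. Quotients: for a wide subgroupoid $\mathcal{H}$, define $g\equiv_{\mathcal{H}}l$ iff $\exists l^{-1}g$ and $l^{-1}g\in\mathcal{H}$; this is an equivalence relation, and the class of $g$ is the left coset $g\mathcal{H}=\{gh\mid h\in\mathcal{H},\ r(h)=d(g)\}$. If $\mathcal{H}$ is normal, the quotient groupoid $\mathcal{G}/\mathcal{H}$ is the set of all left cosets, with $\exists (g\mathcal{H})(l\mathcal{H})$ if and only if $\exists gl$, and in that case $(g\mathcal{H})(l\mathcal{H})=gl\mathcal{H}$. A map $\phi:\mathcal{G}\to\mathcal{G}'$ between groupoids is a homomorphism if for all $x,y\in\mathcal{G}$, $\exists xy$ implies $\exists\phi(x)\phi(y)$ and $\phi(xy)=\phi(x)\phi(y)$. It is a strong homomorphism if moreover $\exists\phi(x)\phi(y)$ implies $\exists xy$. Two groupoids are isomorphic if there is a bijective strong homomorphism between them. Partial isomorphisms: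 $\mathcal{A}(\mathcal{G})=\{f:\mathcal{G}_e\to\mathcal{G}_{e'}\mid e,e'\in\mathcal{G}_0\text{ and }f\text{ is an isomorphism}\}$. For $f,k\in\mathcal{A}(\mathcal{G})$, $\exists f\circ k$ if and only if $D(f)=R(k)$, where $D$ and $R$ denote domain and range, and then $(f\circ k)(x)=f(k(x))$ for $x\in D(k)$. With this partial operation $\mathcal{A}(\mathcal{G})$ is a groupoid, with $d(f)=\mathrm{id}_{D(f)}$, $r(f)=\mathrm{id}_{R(f)}$ and $f^{-1}$ the inverse map. For $g\in\mathcal{G}$, the partial inner isomorphism $\mathcal{I}_g:\mathcal{G}_{d(g)}\to\mathcal{G}_{r(g)}$ is $\mathcal{I}_g(x)=gxg^{-1}$, an element of $\mathcal{A}(\mathcal{G})$, and $\mathcal{I}(\mathcal{G})=\{\mathcal{I}_g\mid g\in\mathcal{G}\}$. $\mathcal{I}(\mathrm{Iso}(\mathcal{G}))$ is the corresponding set for the groupoid $\mathrm{Iso}(\mathcal{G})$, i.e. $\{\mathcal{I}_g\mid g\in\mathrm{Iso}(\mathcal{G})\}$. A wide subgroupoid $\mathcal{H}$ of $\mathcal{G}$ is invariant by the partial inner isomorphism $\mathcal{I}_g$ if $\mathcal{I}_g(\mathcal{H}\cap D(\mathcal{I}_g))=\mathcal{H}\cap R(\mathcal{I}_g)$, that is, $\mathcal{I}_g(\mathcal{H}\cap\mathcal{G}_{d(g)})=\mathcal{H}\cap\mathcal{G}_{r(g)}$. *)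

theory Defs
  imports "HOL-Algebra.Group"
begin

section \<open>Groupoids\<close>

text \<open>
  The partial operation is an option-valued function: \<open>pcomp G g h = None\<close> means that the
  product \<open>gh\<close> is not defined.
\<close>

record 'a groupoid = "'a partial_object" +
  pcomp :: "'a \<Rightarrow> 'a \<Rightarrow> 'a option"

definition composable :: "('a, 'm) groupoid_scheme \<Rightarrow> 'a \<Rightarrow> 'a \<Rightarrow> bool"
  where "composable G g h \<longleftrightarrow> pcomp G g h \<noteq> None"

definition gprod :: "('a, 'm) groupoid_scheme \<Rightarrow> 'a \<Rightarrow> 'a \<Rightarrow> 'a"  (infixl \<open>\<cdot>\<index>\<close> 70)
  where "g \<cdot>\<^bsub>G\<^esub> h = the (pcomp G g h)"

definition identities :: "('a, 'm) groupoid_scheme \<Rightarrow> 'a set"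
  where "identities G =
    {e \<in> carrier G. (\<forall>g \<in> carrier G. composable G e g \<longrightarrow> e \<cdot>\<^bsub>G\<^esub> g = g) \<and>
                    (\<forall>g \<in> carrier G. composable G g e \<longrightarrow> g \<cdot>\<^bsub>G\<^esub> e = g)}"

definition gdom :: "('a, 'm) groupoid_scheme \<Rightarrow> 'a \<Rightarrow> 'a"
  where "gdom G g = (THE d. d \<in> carrier G \<and> composable G g d \<and> g \<cdot>\<^bsub>G\<^esub> d = g)"

definition gran :: "('a, 'm) groupoid_scheme \<Rightarrow> 'a \<Rightarrow> 'a"
  where "gran G g = (THE r. r \<in> carrier G \<and> composable G r g \<and> r \<cdot>\<^bsub>G\<^esub> g = g)"

text \<open>
  The first assumption says that \<open>pcomp G\<close> is a partial operation on the carrier; it is undefined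
  on arguments outside of the carrier.
\<close>

locale groupoid =
  fixes G (structure)
  assumes pcomp_closed:
      "pcomp G g h = Some k \<Longrightarrow> g \<in> carrier G \<and> h \<in> carrier G \<and> k \<in> carrier G"
    and assoc_composable:
      "\<lbrakk>g \<in> carrier G; h \<in> carrier G; l \<in> carrier G\<rbrakk> \<Longrightarrow>
        composable G h l \<and> composable G g (h \<cdot> l) \<longleftrightarrow> composable G g h \<and> composable G (g \<cdot> h) l"
    and assoc:
      "\<lbrakk>g \<in> carrier G; h \<in> carrier G; l \<in> carrier G;
        composable G h l; composable G g (h \<cdot> l)\<rbrakk> \<Longrightarrow> g \<cdot> (h \<cdot> l) = (g \<cdot> h) \<cdot> l"
    and triple_composable:
      "\<lbrakk>g \<in> carrier G; h \<in> carrier G; l \<in> carrier G\<rbrakk> \<Longrightarrow>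
        composable G h l \<and> composable G g (h \<cdot> l) \<longleftrightarrow> composable G g h \<and> composable G h l"
    and ex1_gdom:
      "g \<in> carrier G \<Longrightarrow> \<exists>!d. d \<in> carrier G \<and> composable G g d \<and> g \<cdot> d = g"
    and ex1_gran:
      "g \<in> carrier G \<Longrightarrow> \<exists>!r. r \<in> carrier G \<and> composable G r g \<and> r \<cdot> g = g"
    and ex_inverse:
      "g \<in> carrier G \<Longrightarrow> \<exists>g' \<in> carrier G. composable G g' g \<and> composable G g g' \<and>
        gdom G g = g' \<cdot> g \<and> gran G g = g \<cdot> g'"

text \<open>The groupoid axioms imply that the inverse is unique.\<close>

definition ginv :: "('a, 'm) groupoid_scheme \<Rightarrow> 'a \<Rightarrow> 'a"
  where "ginv G g = (THE g'. g' \<in> carrier G \<and> composable G g' g \<and> composable G g g' \<and>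
    gdom G g = g' \<cdot>\<^bsub>G\<^esub> g \<and> gran G g = g \<cdot>\<^bsub>G\<^esub> g')"

section \<open>Isotropy groups and the center\<close>

definition isotropy :: "('a, 'm) groupoid_scheme \<Rightarrow> 'a \<Rightarrow> 'a set"
  where "isotropy G e = {g \<in> carrier G. gdom G g = e \<and> gran G g = e}"

definition isotropy_group :: "('a, 'm) groupoid_scheme \<Rightarrow> 'a \<Rightarrow> 'a monoid"
  where "isotropy_group G e =
    \<lparr>carrier = isotropy G e, mult = (\<lambda>g h. g \<cdot>\<^bsub>G\<^esub> h), one = e\<rparr>"

definition Iso :: "('a, 'm) groupoid_scheme \<Rightarrow> 'a set"
  where "Iso G = (\<Union>e \<in> identities G. isotropy G e)"

definition abelian_groupoid :: "('a, 'm) groupoid_scheme \<Rightarrow> bool"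
  where "abelian_groupoid G \<longleftrightarrow>
    groupoid G \<and> (\<forall>e \<in> identities G. comm_group (isotropy_group G e))"

definition gcenter :: "('a, 'm) groupoid_scheme \<Rightarrow> 'a set"
  where "gcenter G =
    {g \<in> Iso G. \<forall>h \<in> carrier G. gdom G g = gran G h \<and> gran G h = gdom G h \<longrightarrow>
      g \<cdot>\<^bsub>G\<^esub> h = h \<cdot>\<^bsub>G\<^esub> g}"

section \<open>Subgroupoids and quotients\<close>

definition subgroupoid :: "'a set \<Rightarrow> ('a, 'm) groupoid_scheme \<Rightarrow> bool"
  where "subgroupoid H G \<longleftrightarrow> groupoid G \<and> H \<subseteq> carrier G \<and> H \<noteq> {} \<and>
    (\<forall>g \<in> H. ginv G g \<in> H) \<and> (\<forall>g \<in> H. \<forall>h \<in> H. composable G g h \<longrightarrow> g \<cdot>\<^bsub>G\<^esub> h \<in> H)"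

definition induced_groupoid :: "('a, 'm) groupoid_scheme \<Rightarrow> 'a set \<Rightarrow> 'a groupoid"
  where "induced_groupoid G H =
    \<lparr>carrier = H, pcomp = (\<lambda>g h. if g \<in> H \<and> h \<in> H then pcomp G g h else None)\<rparr>"

definition wide_subgroupoid :: "'a set \<Rightarrow> ('a, 'm) groupoid_scheme \<Rightarrow> bool"
  where "wide_subgroupoid H G \<longleftrightarrow>
    subgroupoid H G \<and> identities (induced_groupoid G H) = identities G"

definition conj_set :: "('a, 'm) groupoid_scheme \<Rightarrow> 'a set \<Rightarrow> 'a \<Rightarrow> 'a set"
  where "conj_set G H g =
    {(ginv G g \<cdot>\<^bsub>G\<^esub> h) \<cdot>\<^bsub>G\<^esub> g | h. h \<in> H \<and> gran G h = gdom G h \<and> gdom G h = gran G g}"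

definition normal_subgroupoid :: "'a set \<Rightarrow> ('a, 'm) groupoid_scheme \<Rightarrow> bool"
  where "normal_subgroupoid H G \<longleftrightarrow>
    wide_subgroupoid H G \<and> (\<forall>g \<in> carrier G. conj_set G H g \<subseteq> H)"

definition left_coset :: "('a, 'm) groupoid_scheme \<Rightarrow> 'a set \<Rightarrow> 'a \<Rightarrow> 'a set"
  where "left_coset G H g = {g \<cdot>\<^bsub>G\<^esub> h | h. h \<in> H \<and> gran G h = gdom G g}"

text \<open>
  The product of two cosets is defined if and only if they have representatives \<open>g\<close> and \<open>l\<close> whose
  product is defined. For normal \<open>H\<close> contained in \<open>Iso G\<close> (in particular for the center) all
  elements of a coset have the same domain and the same range, so that this does not depend on the
  representatives.
\<close>

definition quotient_groupoid :: "('a, 'm) groupoid_scheme \<Rightarrow> 'a set \<Rightarrow> 'a set groupoid"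
  where "quotient_groupoid G H =
    \<lparr>carrier = left_coset G H ` carrier G,
     pcomp = (\<lambda>A B.
       if \<exists>g \<in> carrier G. \<exists>l \<in> carrier G.
            A = left_coset G H g \<and> B = left_coset G H l \<and> composable G g l
       then Some (THE C. \<exists>g \<in> carrier G. \<exists>l \<in> carrier G.
            A = left_coset G H g \<and> B = left_coset G H l \<and> composable G g l \<and>
            C = left_coset G H (g \<cdot>\<^bsub>G\<^esub> l))
       else None)\<rparr>"

section \<open>Homomorphisms\<close>

definition groupoid_hom ::
  "('a, 'm) groupoid_scheme \<Rightarrow> ('b, 'n) groupoid_scheme \<Rightarrow> ('a \<Rightarrow> 'b) \<Rightarrow> bool"
  where "groupoid_hom G G' \<phi> \<longleftrightarrow> groupoid G \<and> groupoid G' \<and> \<phi> \<in> carrier G \<rightarrow> carrier G' \<and>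
    (\<forall>x \<in> carrier G. \<forall>y \<in> carrier G. composable G x y \<longrightarrow>
      composable G' (\<phi> x) (\<phi> y) \<and> \<phi> (x \<cdot>\<^bsub>G\<^esub> y) = \<phi> x \<cdot>\<^bsub>G'\<^esub> \<phi> y)"

definition strong_groupoid_hom ::
  "('a, 'm) groupoid_scheme \<Rightarrow> ('b, 'n) groupoid_scheme \<Rightarrow> ('a \<Rightarrow> 'b) \<Rightarrow> bool"
  where "strong_groupoid_hom G G' \<phi> \<longleftrightarrow> groupoid_hom G G' \<phi> \<and>
    (\<forall>x \<in> carrier G. \<forall>y \<in> carrier G. composable G' (\<phi> x) (\<phi> y) \<longrightarrow> composable G x y)"

definition isomorphic_groupoids ::
  "('a, 'm) groupoid_scheme \<Rightarrow> ('b, 'n) groupoid_scheme \<Rightarrow> bool"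
  where "isomorphic_groupoids G G' \<longleftrightarrow>
    (\<exists>\<phi>. strong_groupoid_hom G G' \<phi> \<and> bij_betw \<phi> (carrier G) (carrier G'))"

section \<open>Partial isomorphisms\<close>

text \<open>
  A map between subsets of the carrier is represented by a partial function \<open>f\<close>, with domain
  \<open>dom f\<close> and, the maps being surjective, range \<open>ran f\<close>.
\<close>

definition partial_isos :: "('a, 'm) groupoid_scheme \<Rightarrow> ('a \<rightharpoonup> 'a) set"
  where "partial_isos G =
    {(\<lambda>x. if x \<in> isotropy G e then Some (f x) else None) | e e' f.
      e \<in> identities G \<and> e' \<in> identities G \<and> f \<in> iso (isotropy_group G e) (isotropy_group G e')}"

definition partial_iso_groupoid :: "('a, 'm) groupoid_scheme \<Rightarrow> ('a \<rightharpoonup> 'a) groupoid"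
  where "partial_iso_groupoid G =
    \<lparr>carrier = partial_isos G,
     pcomp = (\<lambda>f k. if f \<in> partial_isos G \<and> k \<in> partial_isos G \<and> dom f = ran k
                    then Some (f \<circ>\<^sub>m k) else None)\<rparr>"

definition inner_map :: "('a, 'm) groupoid_scheme \<Rightarrow> 'a \<Rightarrow> ('a \<rightharpoonup> 'a)"
  where "inner_map G g =
    (\<lambda>x. if x \<in> isotropy G (gdom G g) then Some ((g \<cdot>\<^bsub>G\<^esub> x) \<cdot>\<^bsub>G\<^esub> ginv G g) else None)"

definition inner_maps :: "('a, 'm) groupoid_scheme \<Rightarrow> ('a \<rightharpoonup> 'a) set"
  where "inner_maps G = inner_map G ` carrier G"

definition inner_groupoid :: "('a, 'm) groupoid_scheme \<Rightarrow> ('a \<rightharpoonup> 'a) groupoid"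
  where "inner_groupoid G = induced_groupoid (partial_iso_groupoid G) (inner_maps G)"

definition invariant_under :: "'a set \<Rightarrow> ('a \<rightharpoonup> 'a) \<Rightarrow> bool"
  where "invariant_under H f \<longleftrightarrow> (\<lambda>x. the (f x)) ` (H \<inter> dom f) = H \<inter> ran f"

end

theory Submission
  imports Defs
begin

text \<open>
  The map \<open>g \<mapsto> I\<^sub>g\<close> is a strong homomorphism into the groupoid of partial isomorphisms, since the
  domain and range of \<open>I\<^sub>g\<close> are isotropy groups and these determine their identities. Hence its
  image is a wide subgroupoid, and it is normal because \<open>I\<^sub>g f = f I\<^sub>k\<close> whenever \<open>f k = g\<close>. An element
  \<open>z\<close> is central if and only if \<open>I\<^sub>z\<close> is an identity, so the cosets of the center are the fibres of
  \<open>g \<mapsto> I\<^sub>g\<close>, which gives both the isomorphism with the quotient and, read on a single isotropy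
  group, the criterion for being abelian. Finally \<open>g H g\<inverse>\<close> is the image of \<open>H\<close> under \<open>I\<^sub>g\<close>; normality
  gives one inclusion for \<open>g\<close> and the other one from \<open>g\<inverse>\<close>.
\<close>

section \<open>Calculus in a groupoid\<close>

context groupoid
begin

lemma composable_carrier:
  assumes "composable G g h"
  shows "g \<in> carrier G" "h \<in> carrier G" "g \<cdot> h \<in> carrier G"
  using assms pcomp_closed by (auto simp: composable_def gprod_def)

text \<open>\<open>triple_composable\<close> turns pairwise composability into composability of the
  triple product, and \<open>assoc_composable\<close> then moves the brackets.\<close>

lemma composable_trans:
  assumes "composable G g h" "composable G h l"
  shows "composable G g (h \<cdot> l)" "composable G (g \<cdot> h) l" "g \<cdot> (h \<cdot> l) = (g \<cdot> h) \<cdot> l"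
proof -
  have C: "g \<in> carrier G" "h \<in> carrier G" "l \<in> carrier G"
    using assms composable_carrier by blast+
  show 1: "composable G g (h \<cdot> l)" using triple_composable[OF C] assms by blast
  show "composable G (g \<cdot> h) l" using assoc_composable[OF C] assms 1 by blast
  show "g \<cdot> (h \<cdot> l) = (g \<cdot> h) \<cdot> l" using assoc[OF C] assms 1 by blast
qed

lemma composable_right:
  assumes "composable G g h" "composable G (g \<cdot> h) l"
  shows "composable G h l"
  using assoc_composable assms composable_carrier by blast

section \<open>Domain and range units, and the composability criterion\<close>

lemma gdom_right:
  assumes "g \<in> carrier G"
  shows "gdom G g \<in> carrier G" "composable G g (gdom G g)" "g \<cdot> gdom G g = g"
  using theI'[OF ex1_gdom[OF assms]] by (simp_all add: gdom_def)

lemma gran_left: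
  assumes "g \<in> carrier G"
  shows "gran G g \<in> carrier G" "composable G (gran G g) g" "gran G g \<cdot> g = g"
  using theI'[OF ex1_gran[OF assms]] by (simp_all add: gran_def)

lemma gdom_eqI: "composable G g d \<Longrightarrow> g \<cdot> d = g \<Longrightarrow> gdom G g = d"
  using ex1_gdom[of g] gdom_right[of g] composable_carrier by blast

lemma gran_eqI: "composable G r g \<Longrightarrow> r \<cdot> g = g \<Longrightarrow> gran G g = r"
  using ex1_gran[of g] gran_left[of g] composable_carrier by blast

text \<open>Rewriting \<open>g\<close> as \<open>g d\<close> with \<open>d = gdom G g\<close> makes
  \<open>d d\<close> defined. Then \<open>d d\<close> is again a right unit of \<open>g\<close>, and
  right units are unique.\<close>

lemma gdom_idem:
  assumes "g \<in> carrier G"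
  shows "composable G (gdom G g) (gdom G g)" "gdom G g \<cdot> gdom G g = gdom G g"
proof -
  let ?d = "gdom G g"
  note d = gdom_right[OF assms]
  show dd: "composable G ?d ?d" using composable_right[OF d(2), of ?d] d by simp
  have "g \<cdot> (?d \<cdot> ?d) = g" using composable_trans(3)[OF d(2) dd] d by simp
  then show "?d \<cdot> ?d = ?d" using composable_trans(1)[OF d(2) dd] gdom_eqI by metis
qed

lemma gran_idem:
  assumes "g \<in> carrier G"
  shows "composable G (gran G g) (gran G g)" "gran G g \<cdot> gran G g = gran G g"
proof -
  let ?r = "gran G g"
  note r = gran_left[OF assms]
  show rr: "composable G ?r ?r"
    using triple_composable[of ?r ?r g] assms r by simp
  have "(?r \<cdot> ?r) \<cdot> g = g" using composable_trans(3)[OF rr r(2)] r by simp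
  then show "?r \<cdot> ?r = ?r" using composable_trans(2)[OF rr r(2)] gran_eqI by metis
qed

text \<open>The product \<open>k = e f\<close> has range \<open>e\<close> and domain
  \<open>f\<close>, so an inverse \<open>k'\<close> of it links the two idempotents. It yields a
  right unit of \<open>e\<close> and then a left unit of \<open>e\<close>, and uniqueness of units
  does the rest.\<close>

lemma composable_idem_eq:
  assumes ef: "composable G e f"
    and ee: "composable G e e" "e \<cdot> e = e"
    and ff: "composable G f f" "f \<cdot> f = f"
  shows "e = f"
proof -
  let ?k = "e \<cdot> f"
  have k: "?k \<in> carrier G" using composable_carrier[OF ef] by simp
  have "gran G ?k = e"
    using composable_trans[OF ee(1) ef] ee(2) by (intro gran_eqI) simp_all
  moreover have "gdom G ?k = f"
    using composable_trans[OF ef ff(1)] ff(2) by (intro gdom_eqI) simp_all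
  ultimately obtain k' where k': "composable G k' ?k" "composable G ?k k'" "f = k' \<cdot> ?k" "e = ?k \<cdot> k'"
    using ex_inverse[OF k] by metis
  have fk': "composable G f k'" using composable_right[OF ef k'(2)] .
  \<comment> \<open>Rebracketed, this is \<open>k k' = e\<close>; it makes \<open>f k'\<close> a
    right unit of the idempotent \<open>e\<close>.\<close>
  have "e \<cdot> (f \<cdot> k') = e" using composable_trans(3)[OF ef fk'] k'(4) by simp
  then have e: "f \<cdot> k' = e"
    using gdom_eqI[OF ee] gdom_eqI[of e "f \<cdot> k'"] composable_trans(1)[OF ef fk'] by simp
  \<comment> \<open>Since \<open>e = f k'\<close> and \<open>f\<close> is idempotent,
    \<open>f\<close> is absorbed on the left, so it is a left unit of \<open>e\<close>.\<close>
  have "composable G f e" "f \<cdot> e = e"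
    using composable_trans[OF ff(1) fk'] ff(2) e by simp_all
  then show ?thesis using gran_eqI[of f e] gran_eqI[OF ee] by simp
qed

text \<open>This is the passage from the axioms to the language of categories: from here on,
  composability is an equation between a domain and a range. It rests on the equality of composable
  idempotents.\<close>

lemma composable_iff:
  "composable G g h \<longleftrightarrow> g \<in> carrier G \<and> h \<in> carrier G \<and> gdom G g = gran G h"
proof (intro iffI conjI; (elim conjE)?)
  assume gh: "composable G g h"
  show g: "g \<in> carrier G" and h: "h \<in> carrier G" using composable_carrier[OF gh] by auto
  \<comment> \<open>Splitting \<open>g\<close> as \<open>g\<close> times its domain unit, and
    \<open>h\<close> as its range unit times \<open>h\<close>, brings the two units next to each
    other as composable idempotents.\<close>
  have dh: "composable G (gdom G g) h"
    using composable_right[of g "gdom G g" h] gdom_right[OF g] gh by simp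
  then have "composable G (gdom G g) (gran G h)"
    using triple_composable[of "gdom G g" "gran G h" h] gran_left[OF h] gdom_right(1)[OF g] h by metis
  then show "gdom G g = gran G h"
    using composable_idem_eq gdom_idem[OF g] gran_idem[OF h] by blast
next
  assume *: "g \<in> carrier G" "h \<in> carrier G" "gdom G g = gran G h"
  then show "composable G g h"
    using composable_trans(1)[OF gdom_right(2)[OF *(1)], of h] gran_left[OF *(2)] by simp
qed

lemma gprod_closed: "\<lbrakk>g \<in> carrier G; h \<in> carrier G; gdom G g = gran G h\<rbrakk> \<Longrightarrow> g \<cdot> h \<in> carrier G"
  using composable_carrier(3)[of g h] by (simp add: composable_iff)

lemma gprod_assoc:
  "\<lbrakk>g \<in> carrier G; h \<in> carrier G; l \<in> carrier G; gdom G g = gran G h; gdom G h = gran G l\<rbrakk>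
    \<Longrightarrow> (g \<cdot> h) \<cdot> l = g \<cdot> (h \<cdot> l)"
  using composable_trans(3)[of g h l] by (simp add: composable_iff)

lemma gdom_gprod:
  assumes "g \<in> carrier G" "h \<in> carrier G" "gdom G g = gran G h"
  shows "gdom G (g \<cdot> h) = gdom G h"
  using assms composable_trans[of g h "gdom G h"] gdom_right[of h]
  by (intro gdom_eqI) (simp_all add: composable_iff)

lemma gran_gprod:
  assumes "g \<in> carrier G" "h \<in> carrier G" "gdom G g = gran G h"
  shows "gran G (g \<cdot> h) = gran G g"
  using assms composable_trans[of "gran G g" g h] gran_left[of g]
  by (intro gran_eqI) (simp_all add: composable_iff)

lemma gdom_ran_unit:
  assumes "g \<in> carrier G"
  shows "gdom G (gdom G g) = gdom G g" "gran G (gdom G g) = gdom G g"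
    "gdom G (gran G g) = gran G g" "gran G (gran G g) = gran G g"
  using gdom_idem[OF assms] gran_idem[OF assms] by (simp_all add: gdom_eqI gran_eqI)

lemma gprod_unit_left: "\<lbrakk>g \<in> carrier G; gran G g = e\<rbrakk> \<Longrightarrow> e \<cdot> g = g"
  using gran_left(3) by blast

lemma gprod_unit_right: "\<lbrakk>g \<in> carrier G; gdom G g = e\<rbrakk> \<Longrightarrow> g \<cdot> e = g"
  using gdom_right(3) by blast

section \<open>Inverses and cancellation\<close>

lemma inverse_unique:
  assumes "composable G g' g" "g' \<cdot> g = gdom G g"
    and "composable G g g''" "g \<cdot> g'' = gran G g"
  shows "g' = g''"
proof -
  have C: "g \<in> carrier G" "g' \<in> carrier G" "g'' \<in> carrier G"
    using assms composable_carrier by blast+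
  have "g' = g' \<cdot> (g \<cdot> g'')"
    using assms C by (simp add: composable_iff gprod_unit_right)
  also have "\<dots> = (g' \<cdot> g) \<cdot> g''" by (rule composable_trans(3)[OF assms(1,3)])
  also have "\<dots> = g''" using assms C by (simp add: composable_iff gprod_unit_left)
  finally show ?thesis .
qed

lemma ginv_inverse:
  assumes "g \<in> carrier G"
  shows "ginv G g \<in> carrier G" "composable G (ginv G g) g" "composable G g (ginv G g)"
    "ginv G g \<cdot> g = gdom G g" "g \<cdot> ginv G g = gran G g"
proof -
  let ?P = "\<lambda>g'. g' \<in> carrier G \<and> composable G g' g \<and> composable G g g' \<and>
    gdom G g = g' \<cdot> g \<and> gran G g = g \<cdot> g'"
  have "\<exists>!g'. ?P g'" using ex_inverse[OF assms] inverse_unique by metis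
  then have "?P (ginv G g)" unfolding ginv_def by (rule theI')
  then show "ginv G g \<in> carrier G" "composable G (ginv G g) g" "composable G g (ginv G g)"
    "ginv G g \<cdot> g = gdom G g" "g \<cdot> ginv G g = gran G g" by simp_all
qed

text \<open>A left inverse is enough, because \<open>ginv G g\<close> itself serves as the right
  inverse in \<open>inverse_unique\<close>.\<close>

lemma ginv_eqI: "\<lbrakk>composable G g' g; g' \<cdot> g = gdom G g\<rbrakk> \<Longrightarrow> ginv G g = g'"
  using inverse_unique[of g' g "ginv G g"] ginv_inverse[of g] composable_carrier by metis

lemma gdom_ginv: "g \<in> carrier G \<Longrightarrow> gdom G (ginv G g) = gran G g"
  using ginv_inverse[of g] by (simp add: composable_iff)

lemma gran_ginv: "g \<in> carrier G \<Longrightarrow> gran G (ginv G g) = gdom G g"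
  using ginv_inverse[of g] by (simp add: composable_iff)

lemma ginv_cancel_left:
  "\<lbrakk>g \<in> carrier G; h \<in> carrier G; gdom G g = gran G h\<rbrakk> \<Longrightarrow> ginv G g \<cdot> (g \<cdot> h) = h"
  by (metis gprod_assoc ginv_inverse(1,4) gdom_ginv gprod_unit_left)

lemma ginv_cancel_right:
  "\<lbrakk>g \<in> carrier G; h \<in> carrier G; gran G g = gran G h\<rbrakk> \<Longrightarrow> g \<cdot> (ginv G g \<cdot> h) = h"
  by (metis gprod_assoc ginv_inverse(1,5) gdom_ginv gran_ginv gprod_unit_left)

lemma ginv_ginv: "g \<in> carrier G \<Longrightarrow> ginv G (ginv G g) = g"
  by (rule ginv_eqI) (simp_all add: ginv_inverse gdom_ginv)

lemma ginv_gprod: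
  assumes "g \<in> carrier G" "h \<in> carrier G" "gdom G g = gran G h"
  shows "ginv G (g \<cdot> h) = ginv G h \<cdot> ginv G g"
  using assms
  by (intro ginv_eqI)
    (simp_all add: composable_iff gprod_closed gdom_gprod gran_gprod gdom_ginv gran_ginv
      ginv_inverse gprod_assoc ginv_cancel_left)

text \<open>A rewrite system for words: products are bracketed to the right, the two cancellation
  rules remove inverse pairs in that form, and side conditions reduce to equations between domains
  and ranges.\<close>

lemmas groupoid_simps =
  composable_iff gprod_closed gdom_gprod gran_gprod gdom_ginv gran_ginv ginv_inverse
  gdom_right(1) gran_left(1) gdom_ran_unit gprod_assoc gprod_unit_left gprod_unit_right
  ginv_cancel_left ginv_cancel_right ginv_ginv ginv_gprod

lemma identities_unit:
  assumes "e \<in> identities G"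
  shows "e \<in> carrier G" "gdom G e = e" "gran G e = e"
proof -
  show e: "e \<in> carrier G" using assms by (simp add: identities_def)
  \<comment> \<open>The same product equals \<open>e\<close>, because \<open>gdom G e\<close> is a
    right unit of \<open>e\<close>.\<close>
  have "e \<cdot> gdom G e = gdom G e"
    using assms gdom_right[OF e] by (simp add: identities_def)
  then show 1: "gdom G e = e" using gdom_right[OF e] by simp
  show "gran G e = e" using gdom_ran_unit(2)[OF e] 1 by simp
qed

lemma gdom_identities: "g \<in> carrier G \<Longrightarrow> gdom G g \<in> identities G"
  by (auto simp: identities_def groupoid_simps)

lemma gran_identities: "g \<in> carrier G \<Longrightarrow> gran G g \<in> identities G"
  by (auto simp: identities_def groupoid_simps)

lemma identities_iff: "e \<in> identities G \<longleftrightarrow> e \<in> carrier G \<and> gdom G e = e"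
  using identities_unit gdom_identities by metis

lemma ginv_unit: "e \<in> identities G \<Longrightarrow> ginv G e = e"
  by (rule ginv_eqI) (simp_all add: identities_unit groupoid_simps)

end

text \<open>The objects of the category are the values of \<open>D\<close> and \<open>R\<close>, and \<open>u\<close> sends an object to its
  identity morphism.\<close>

lemma groupoidI:
  assumes pcomp: "\<And>g h. composable G g h \<longleftrightarrow> g \<in> carrier G \<and> h \<in> carrier G \<and> D g = R h"
    and closed: "\<And>g h. \<lbrakk>g \<in> carrier G; h \<in> carrier G; D g = R h\<rbrakk> \<Longrightarrow> g \<cdot>\<^bsub>G\<^esub> h \<in> carrier G"
    and D: "\<And>g h. \<lbrakk>g \<in> carrier G; h \<in> carrier G; D g = R h\<rbrakk> \<Longrightarrow> D (g \<cdot>\<^bsub>G\<^esub> h) = D h"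
    and R: "\<And>g h. \<lbrakk>g \<in> carrier G; h \<in> carrier G; D g = R h\<rbrakk> \<Longrightarrow> R (g \<cdot>\<^bsub>G\<^esub> h) = R g"
    and assoc: "\<And>g h l. \<lbrakk>g \<in> carrier G; h \<in> carrier G; l \<in> carrier G; D g = R h; D h = R l\<rbrakk>
      \<Longrightarrow> g \<cdot>\<^bsub>G\<^esub> (h \<cdot>\<^bsub>G\<^esub> l) = (g \<cdot>\<^bsub>G\<^esub> h) \<cdot>\<^bsub>G\<^esub> l"
    and unit_D: "\<And>g. g \<in> carrier G \<Longrightarrow> u (D g) \<in> carrier G \<and> R (u (D g)) = D g \<and> g \<cdot>\<^bsub>G\<^esub> u (D g) = g"
    and unit_R: "\<And>g. g \<in> carrier G \<Longrightarrow> u (R g) \<in> carrier G \<and> D (u (R g)) = R g \<and> u (R g) \<cdot>\<^bsub>G\<^esub> g = g"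
    and inverse: "\<And>g. g \<in> carrier G \<Longrightarrow> \<exists>g' \<in> carrier G. D g' = R g \<and> R g' = D g \<and>
      g' \<cdot>\<^bsub>G\<^esub> g = u (D g) \<and> g \<cdot>\<^bsub>G\<^esub> g' = u (R g)"
  shows "groupoid G"
proof -
  have ex1D: "\<exists>!d. d \<in> carrier G \<and> composable G g d \<and> g \<cdot>\<^bsub>G\<^esub> d = g" if g: "g \<in> carrier G" for g
  proof (rule ex1I)
    show "u (D g) \<in> carrier G \<and> composable G g (u (D g)) \<and> g \<cdot>\<^bsub>G\<^esub> u (D g) = g"
      using unit_D[OF g] g by (simp add: pcomp)
  next
    fix d assume d: "d \<in> carrier G \<and> composable G g d \<and> g \<cdot>\<^bsub>G\<^esub> d = g"
    obtain g' where g': "g' \<in> carrier G" "D g' = R g" "g' \<cdot>\<^bsub>G\<^esub> g = u (D g)"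
      using inverse[OF g] by blast
    \<comment> \<open>Composability of \<open>g\<close> and \<open>d\<close> means
      \<open>R d = D g\<close>, so \<open>g' g = u (D g)\<close> is a left unit of \<open>d\<close>.
      Rebracketing and absorbing \<open>d\<close> into \<open>g\<close> leaves
      \<open>g' g\<close>.\<close>
    have "d = g' \<cdot>\<^bsub>G\<^esub> g \<cdot>\<^bsub>G\<^esub> d"
      using unit_R[of d] d g'(3) by (simp add: pcomp)
    also have "\<dots> = u (D g)"
      using assoc[of g' g d] d g' g by (simp add: pcomp)
    finally show "d = u (D g)" .
  qed
  have ex1R: "\<exists>!r. r \<in> carrier G \<and> composable G r g \<and> r \<cdot>\<^bsub>G\<^esub> g = g" if g: "g \<in> carrier G" for g
  proof (rule ex1I)
    show "u (R g) \<in> carrier G \<and> composable G (u (R g)) g \<and> u (R g) \<cdot>\<^bsub>G\<^esub> g = g"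
      using unit_R[OF g] g by (simp add: pcomp)
  next
    fix r assume r: "r \<in> carrier G \<and> composable G r g \<and> r \<cdot>\<^bsub>G\<^esub> g = g"
    obtain g' where g': "g' \<in> carrier G" "R g' = D g" "g \<cdot>\<^bsub>G\<^esub> g' = u (R g)"
      using inverse[OF g] by blast
    have "r = r \<cdot>\<^bsub>G\<^esub> (g \<cdot>\<^bsub>G\<^esub> g')"
      using unit_D[of r] r g'(3) by (simp add: pcomp)
    also have "\<dots> = u (R g)"
      using assoc[of r g g'] r g' g by (simp add: pcomp)
    finally show "r = u (R g)" .
  qed
  have gdom: "gdom G g = u (D g)" if g: "g \<in> carrier G" for g
    unfolding gdom_def using unit_D[OF g] g by (intro the1_equality[OF ex1D[OF g]]) (simp add: pcomp)
  have gran: "gran G g = u (R g)" if g: "g \<in> carrier G" for g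
    unfolding gran_def using unit_R[OF g] g by (intro the1_equality[OF ex1R[OF g]]) (simp add: pcomp)
  show ?thesis
  proof
    fix g h k assume "pcomp G g h = Some k"
    then show "g \<in> carrier G \<and> h \<in> carrier G \<and> k \<in> carrier G"
      using pcomp[of g h] closed[of g h] by (auto simp: composable_def gprod_def)
  next
    fix g assume g: "g \<in> carrier G"
    show "\<exists>g'\<in>carrier G. composable G g' g \<and> composable G g g' \<and>
        gdom G g = g' \<cdot>\<^bsub>G\<^esub> g \<and> gran G g = g \<cdot>\<^bsub>G\<^esub> g'"
      using inverse[OF g] g gdom[OF g] gran[OF g] by (fastforce simp: pcomp)
  qed (use pcomp closed D R assoc ex1D ex1R in auto)
qed

section \<open>Subgroupoids and homomorphisms\<close>

lemma induced_groupoid_simps: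
  "carrier (induced_groupoid G H) = H"
  "composable (induced_groupoid G H) g h \<longleftrightarrow> g \<in> H \<and> h \<in> H \<and> composable G g h"
  "\<lbrakk>g \<in> H; h \<in> H\<rbrakk> \<Longrightarrow> g \<cdot>\<^bsub>induced_groupoid G H\<^esub> h = g \<cdot>\<^bsub>G\<^esub> h"
  by (auto simp: induced_groupoid_def composable_def gprod_def)

context groupoid
begin

lemma subgroupoid_unit:
  assumes "subgroupoid H G" "g \<in> H"
  shows "gdom G g \<in> H" "gran G g \<in> H"
proof -
  have g: "g \<in> carrier G" "ginv G g \<in> H" using assms by (auto simp: subgroupoid_def)
  then have "ginv G g \<cdot> g \<in> H" "g \<cdot> ginv G g \<in> H"
    using assms ginv_inverse(2,3)[OF g(1)] unfolding subgroupoid_def by blast+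
  then show "gdom G g \<in> H" "gran G g \<in> H" using g by (simp_all add: ginv_inverse)
qed

lemma groupoid_induced:
  assumes H: "subgroupoid H G"
  shows "groupoid (induced_groupoid G H)"
proof -
  have sub: "H \<subseteq> carrier G" and inv: "\<And>g. g \<in> H \<Longrightarrow> ginv G g \<in> H"
    and prod: "\<And>g h. \<lbrakk>g \<in> H; h \<in> H; gdom G g = gran G h\<rbrakk> \<Longrightarrow> g \<cdot> h \<in> H"
    using H by (auto simp: subgroupoid_def composable_iff subset_iff)
  note simps = induced_groupoid_simps groupoid_simps subsetD[OF sub] inv prod
    subgroupoid_unit[OF H]
  show ?thesis
  \<comment> \<open>Objects are represented by their own identity elements, hence
    \<open>u = id\<close>.\<close>
  proof (rule groupoidI[where D = "gdom G" and R = "gran G" and u = id])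
    let ?H = "induced_groupoid G H"
    show "\<exists>g'\<in>carrier ?H. gdom G g' = gran G g \<and> gran G g' = gdom G g \<and>
        g' \<cdot>\<^bsub>?H\<^esub> g = id (gdom G g) \<and> g \<cdot>\<^bsub>?H\<^esub> g' = id (gran G g)" if "g \<in> carrier ?H" for g
      using that by (intro bexI[of _ "ginv G g"]) (simp_all add: simps)
  qed (auto simp: simps)
qed

text \<open>Domain units computed in the induced groupoid agree with those in \<open>G\<close>, so
  its identities are the identities of \<open>G\<close> that lie in \<open>H\<close>.\<close>

lemma wide_subgroupoid_iff:
  "wide_subgroupoid H G \<longleftrightarrow> subgroupoid H G \<and> identities G \<subseteq> H"
proof -
  have "identities (induced_groupoid G H) = H \<inter> identities G" if H: "subgroupoid H G"
  proof -
    interpret I: groupoid "induced_groupoid G H" by (rule groupoid_induced[OF H])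
    have sub: "H \<subseteq> carrier G" using H by (simp add: subgroupoid_def)
    have "gdom (induced_groupoid G H) e = gdom G e" if "e \<in> H" for e
      using that sub subgroupoid_unit[OF H that]
      by (intro I.gdom_eqI) (auto simp: induced_groupoid_simps groupoid_simps)
    then show ?thesis
      using sub by (auto simp: I.identities_iff identities_iff induced_groupoid_simps)
  qed
  then show ?thesis unfolding wide_subgroupoid_def by blast
qed

text \<open>Applying \<open>\<phi>\<close> to the defining equations of units and inverses gives
  equations in \<open>G'\<close> whose solutions are unique.\<close>

lemma groupoid_hom_units:
  assumes "groupoid_hom G G' \<phi>" "g \<in> carrier G"
  shows "\<phi> (gdom G g) = gdom G' (\<phi> g)" "\<phi> (gran G g) = gran G' (\<phi> g)"
    "\<phi> (ginv G g) = ginv G' (\<phi> g)"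
proof -
  interpret G': groupoid G' using assms by (simp add: groupoid_hom_def)
  have hom: "composable G' (\<phi> x) (\<phi> y)" "\<phi> (x \<cdot> y) = \<phi> x \<cdot>\<^bsub>G'\<^esub> \<phi> y"
    if "composable G x y" for x y
    using assms that by (auto simp: groupoid_hom_def composable_iff)
  show 1: "\<phi> (gdom G g) = gdom G' (\<phi> g)"
    using hom[OF gdom_right(2)[OF assms(2)]] assms(2)
    by (intro G'.gdom_eqI[symmetric]) (simp_all add: groupoid_simps)
  show "\<phi> (gran G g) = gran G' (\<phi> g)"
    using hom[OF gran_left(2)[OF assms(2)]] assms(2)
    by (intro G'.gran_eqI[symmetric]) (simp_all add: groupoid_simps)
  show "\<phi> (ginv G g) = ginv G' (\<phi> g)"
    using hom[OF ginv_inverse(2)[OF assms(2)]] assms(2) 1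
    by (intro G'.ginv_eqI[symmetric]) (simp_all add: groupoid_simps)
qed

text \<open>Strength is what makes the image closed under products: a product of two values is then
  the value of a product.\<close>

lemma subgroupoid_strong_image:
  assumes "strong_groupoid_hom G G' \<phi>" "carrier G \<noteq> {}"
  shows "subgroupoid (\<phi> ` carrier G) G'"
proof -
  have hom: "groupoid_hom G G' \<phi>" using assms by (simp add: strong_groupoid_hom_def)
  have "\<phi> x \<cdot>\<^bsub>G'\<^esub> \<phi> y \<in> \<phi> ` carrier G"
    if "x \<in> carrier G" "y \<in> carrier G" "composable G' (\<phi> x) (\<phi> y)" for x y
  proof -
    have "composable G x y" using assms(1) that by (simp add: strong_groupoid_hom_def)
    then show ?thesis
      using hom that composable_carrier(3)[of x y] by (auto simp: groupoid_hom_def intro: rev_image_eqI)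
  qed
  moreover have "ginv G' (\<phi> x) \<in> \<phi> ` carrier G" if "x \<in> carrier G" for x
    using groupoid_hom_units(3)[OF hom that] that ginv_inverse(1) by (metis imageI)
  ultimately show ?thesis
    using hom assms(2) by (auto simp: subgroupoid_def groupoid_hom_def)
qed

text \<open>Cutting the target down to the image makes the map surjective, which is the form that
  \<open>isomorphic_quotient\<close> takes.\<close>

lemma strong_hom_induced:
  assumes "strong_groupoid_hom G G' \<phi>" "carrier G \<noteq> {}"
  shows "strong_groupoid_hom G (induced_groupoid G' (\<phi> ` carrier G)) \<phi>"
proof -
  interpret G': groupoid G' using assms by (simp add: strong_groupoid_hom_def groupoid_hom_def)
  have "groupoid (induced_groupoid G' (\<phi> ` carrier G))"
    by (rule G'.groupoid_induced[OF subgroupoid_strong_image[OF assms]])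
  then show ?thesis
    using assms by (auto simp: strong_groupoid_hom_def groupoid_hom_def induced_groupoid_simps)
qed

end

text \<open>Transport of structure along a bijection. Since \<open>G\<close> is only shown here to
  be a groupoid, the homomorphism conditions are spelled out. It spares checking the axioms on
  cosets.\<close>

lemma groupoid_transfer:
  assumes "groupoid G'" and bij: "bij_betw \<phi> (carrier G) (carrier G')"
    and comp: "\<And>x y. composable G x y \<longleftrightarrow>
      x \<in> carrier G \<and> y \<in> carrier G \<and> composable G' (\<phi> x) (\<phi> y)"
    and prod: "\<And>x y. composable G x y \<Longrightarrow> x \<cdot>\<^bsub>G\<^esub> y \<in> carrier G \<and> \<phi> (x \<cdot>\<^bsub>G\<^esub> y) = \<phi> x \<cdot>\<^bsub>G'\<^esub> \<phi> y"
  shows "groupoid G"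
proof -
  interpret G': groupoid G' by fact
  let ?\<psi> = "inv_into (carrier G) \<phi>"
  have \<phi>: "\<phi> x \<in> carrier G'" if "x \<in> carrier G" for x using bij that by (auto simp: bij_betw_def)
  have \<psi>: "?\<psi> z \<in> carrier G" "\<phi> (?\<psi> z) = z" if "z \<in> carrier G'" for z
    using bij that by (auto simp: bij_betw_def inv_into_into f_inv_into_f)
  have inj: "x = y" if "\<phi> x = \<phi> y" "x \<in> carrier G" "y \<in> carrier G" for x y
    using bij that by (auto simp: bij_betw_def inj_on_def)
  have prod': "x \<cdot>\<^bsub>G\<^esub> y \<in> carrier G" "\<phi> (x \<cdot>\<^bsub>G\<^esub> y) = \<phi> x \<cdot>\<^bsub>G'\<^esub> \<phi> y"
    if "x \<in> carrier G" "y \<in> carrier G" "gdom G' (\<phi> x) = gran G' (\<phi> y)" for x y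
    using that prod[of x y] comp[of x y] by (auto simp: G'.composable_iff \<phi>)
  note simps = \<phi> \<psi> prod' G'.groupoid_simps
  show ?thesis
  \<comment> \<open>The objects are the identities of \<open>G'\<close>; the identity morphism at an
    object is its preimage under \<open>\<phi>\<close>. Equations in \<open>G\<close> are verified
    after applying \<open>\<phi>\<close>, by injectivity.\<close>
  proof (rule groupoidI[where D = "gdom G' \<circ> \<phi>" and R = "gran G' \<circ> \<phi>" and u = ?\<psi>])
    fix g assume g: "g \<in> carrier G"
    show "?\<psi> ((gdom G' \<circ> \<phi>) g) \<in> carrier G \<and>
        (gran G' \<circ> \<phi>) (?\<psi> ((gdom G' \<circ> \<phi>) g)) = (gdom G' \<circ> \<phi>) g \<and>
        g \<cdot>\<^bsub>G\<^esub> ?\<psi> ((gdom G' \<circ> \<phi>) g) = g"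
      using g by (auto simp: simps intro!: inj)
    show "?\<psi> ((gran G' \<circ> \<phi>) g) \<in> carrier G \<and>
        (gdom G' \<circ> \<phi>) (?\<psi> ((gran G' \<circ> \<phi>) g)) = (gran G' \<circ> \<phi>) g \<and>
        ?\<psi> ((gran G' \<circ> \<phi>) g) \<cdot>\<^bsub>G\<^esub> g = g"
      using g by (auto simp: simps intro!: inj)
    show "\<exists>g'\<in>carrier G. (gdom G' \<circ> \<phi>) g' = (gran G' \<circ> \<phi>) g \<and>
        (gran G' \<circ> \<phi>) g' = (gdom G' \<circ> \<phi>) g \<and>
        g' \<cdot>\<^bsub>G\<^esub> g = ?\<psi> ((gdom G' \<circ> \<phi>) g) \<and> g \<cdot>\<^bsub>G\<^esub> g' = ?\<psi> ((gran G' \<circ> \<phi>) g)"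
      using g by (intro bexI[of _ "?\<psi> (ginv G' (\<phi> g))"]) (auto simp: simps intro!: inj)
  qed (auto simp: simps comp intro!: inj)
qed

text \<open>Since the fibres of \<open>\<phi>\<close> are the cosets and \<open>\<phi>\<close> reflects composability, neither the existence
  nor the value of a product of cosets depends on the representatives, so the definite description
  in the quotient is well defined.\<close>

lemma isomorphic_quotient:
  assumes strong: "strong_groupoid_hom G G' \<phi>" and surj: "\<phi> ` carrier G = carrier G'"
    and fibre: "\<And>x y. \<lbrakk>x \<in> carrier G; y \<in> carrier G\<rbrakk> \<Longrightarrow>
      left_coset G H x = left_coset G H y \<longleftrightarrow> \<phi> x = \<phi> y"
  shows "isomorphic_groupoids (quotient_groupoid G H) G'"
proof -
  interpret G: groupoid G using strong by (simp add: strong_groupoid_hom_def groupoid_hom_def)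
  interpret G': groupoid G' using strong by (simp add: strong_groupoid_hom_def groupoid_hom_def)
  let ?Q = "quotient_groupoid G H" and ?c = "left_coset G H"
  have comp: "composable G' (\<phi> x) (\<phi> y) \<longleftrightarrow> composable G x y"
    if "x \<in> carrier G" "y \<in> carrier G" for x y
    using strong that by (auto simp: strong_groupoid_hom_def groupoid_hom_def)
  have prod: "\<phi> (x \<cdot>\<^bsub>G\<^esub> y) = \<phi> x \<cdot>\<^bsub>G'\<^esub> \<phi> y" if "composable G x y" for x y
    using strong that G.composable_carrier[OF that]
    by (auto simp: strong_groupoid_hom_def groupoid_hom_def)
  \<comment> \<open>The map induced on cosets, through a chosen representative; the fibre hypothesis
    makes its value independent of the choice.\<close>
  define \<psi> where "\<psi> A = \<phi> (inv_into (carrier G) ?c A)" for A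
  have \<psi>: "\<psi> (?c x) = \<phi> x" if "x \<in> carrier G" for x
    using that fibre[of "inv_into (carrier G) ?c (?c x)" x]
    by (simp add: \<psi>_def inv_into_into f_inv_into_f)
  have carr: "carrier ?Q = ?c ` carrier G" by (simp add: quotient_groupoid_def)
  have Qcomp: "composable ?Q (?c x) (?c y) \<longleftrightarrow> composable G x y"
    if x: "x \<in> carrier G" and y: "y \<in> carrier G" for x y
  proof -
    have "(\<exists>g\<in>carrier G. \<exists>l\<in>carrier G. ?c x = ?c g \<and> ?c y = ?c l \<and> composable G g l)
        \<longleftrightarrow> composable G x y"
      using fibre comp x y by metis
    then show ?thesis by (simp add: quotient_groupoid_def composable_def)
  qed
  have Qprod: "?c x \<cdot>\<^bsub>?Q\<^esub> ?c y = ?c (x \<cdot>\<^bsub>G\<^esub> y)" if xy: "composable G x y" for x y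
  proof -
    have C: "x \<in> carrier G" "y \<in> carrier G" "x \<cdot>\<^bsub>G\<^esub> y \<in> carrier G"
      using G.composable_carrier[OF xy] by auto
    have "(THE C. \<exists>g\<in>carrier G. \<exists>l\<in>carrier G. ?c x = ?c g \<and> ?c y = ?c l \<and>
        composable G g l \<and> C = ?c (g \<cdot>\<^bsub>G\<^esub> l)) = ?c (x \<cdot>\<^bsub>G\<^esub> y)"
    proof (rule the_equality)
      show "\<exists>g\<in>carrier G. \<exists>l\<in>carrier G. ?c x = ?c g \<and> ?c y = ?c l \<and>
          composable G g l \<and> ?c (x \<cdot>\<^bsub>G\<^esub> y) = ?c (g \<cdot>\<^bsub>G\<^esub> l)"
        using C xy by blast
    next
      fix C assume "\<exists>g\<in>carrier G. \<exists>l\<in>carrier G. ?c x = ?c g \<and> ?c y = ?c l \<and>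
          composable G g l \<and> C = ?c (g \<cdot>\<^bsub>G\<^esub> l)"
      then obtain g l where gl: "g \<in> carrier G" "l \<in> carrier G" "?c x = ?c g" "?c y = ?c l"
        "composable G g l" "C = ?c (g \<cdot>\<^bsub>G\<^esub> l)" by blast
      \<comment> \<open>Other representatives have the same images under \<open>\<phi>\<close>, so
        their product has the same image and hence the same coset.\<close>
      have "\<phi> (g \<cdot>\<^bsub>G\<^esub> l) = \<phi> (x \<cdot>\<^bsub>G\<^esub> y)"
        using fibre[OF C(1) gl(1)] fibre[OF C(2) gl(2)] gl prod[OF xy] prod[OF gl(5)] by simp
      then show "C = ?c (x \<cdot>\<^bsub>G\<^esub> y)"
        using fibre[OF G.composable_carrier(3)[OF gl(5)] C(3)] gl by simp
    qed
    moreover have "\<exists>g\<in>carrier G. \<exists>l\<in>carrier G. ?c x = ?c g \<and> ?c y = ?c l \<and> composable G g l"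
      using C xy by blast
    ultimately have "pcomp ?Q (?c x) (?c y) = Some (?c (x \<cdot>\<^bsub>G\<^esub> y))"
      by (simp add: quotient_groupoid_def)
    then show ?thesis by (simp add: gprod_def[of ?Q])
  qed
  have Qcarr: "A \<in> carrier ?Q \<and> B \<in> carrier ?Q" if "composable ?Q A B" for A B
    using that by (auto simp: quotient_groupoid_def composable_def split: if_splits)
  have bij: "bij_betw \<psi> (carrier ?Q) (carrier G')"
  proof (rule bij_betw_imageI)
    show "inj_on \<psi> (carrier ?Q)" using fibre by (auto simp: carr inj_on_def \<psi>)
    show "\<psi> ` carrier ?Q = carrier G'" using surj by (simp add: carr image_image \<psi>)
  qed
  have Q: "composable ?Q A B \<longleftrightarrow> A \<in> carrier ?Q \<and> B \<in> carrier ?Q \<and> composable G' (\<psi> A) (\<psi> B)" for A B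
    using Qcarr[of A B] Qcomp comp \<psi> by (fastforce simp: carr)
  have P: "A \<cdot>\<^bsub>?Q\<^esub> B \<in> carrier ?Q \<and> \<psi> (A \<cdot>\<^bsub>?Q\<^esub> B) = \<psi> A \<cdot>\<^bsub>G'\<^esub> \<psi> B" if AB: "composable ?Q A B" for A B
  proof -
    obtain x y where xy: "A = ?c x" "B = ?c y" "x \<in> carrier G" "y \<in> carrier G"
      using Qcarr[OF AB] by (auto simp: carr)
    then have c: "composable G x y" using AB Qcomp by simp
    show ?thesis using xy Qprod[OF c] prod[OF c] G.composable_carrier(3)[OF c] by (simp add: \<psi> carr)
  qed
  \<comment> \<open>The quotient receives the groupoid axioms from \<open>G'\<close> through
    \<open>\<psi>\<close>.\<close>
  have "groupoid ?Q" by (rule groupoid_transfer[OF G'.groupoid_axioms bij Q P])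
  moreover have "\<psi> \<in> carrier ?Q \<rightarrow> carrier G'" using bij by (auto simp: bij_betw_def)
  ultimately have "strong_groupoid_hom ?Q G' \<psi>"
    using Q P G'.groupoid_axioms by (auto simp: strong_groupoid_hom_def groupoid_hom_def)
  then show ?thesis using bij by (auto simp: isomorphic_groupoids_def)
qed


section \<open>Isotropy groups\<close>

context groupoid
begin

lemma isotropy_simps:
  assumes "x \<in> isotropy G e"
  shows "x \<in> carrier G" "gdom G x = e" "gran G x = e"
  using assms by (simp_all add: isotropy_def)

lemma unit_in_isotropy: "e \<in> identities G \<Longrightarrow> e \<in> isotropy G e"
  by (simp add: isotropy_def identities_unit)

text \<open>An identity lies in its own isotropy group and is the domain of itself, so it can be
  recovered from the set. This turns equality of domains and ranges of maps into equality of
  identities.\<close>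

lemma isotropy_eq_iff:
  assumes "e \<in> identities G"
  shows "isotropy G e = isotropy G e' \<longleftrightarrow> e = e'"
  using unit_in_isotropy[OF assms] identities_unit[OF assms] isotropy_simps(2)[of e e'] by auto

lemma isotropy_gprod: "\<lbrakk>x \<in> isotropy G e; y \<in> isotropy G e\<rbrakk> \<Longrightarrow> x \<cdot> y \<in> isotropy G e"
  by (simp add: isotropy_def groupoid_simps)

lemma group_isotropy:
  assumes "e \<in> identities G"
  shows "group (isotropy_group G e)"
proof (rule groupI)
  show "\<exists>y\<in>carrier (isotropy_group G e). y \<otimes>\<^bsub>isotropy_group G e\<^esub> x = \<one>\<^bsub>isotropy_group G e\<^esub>"
    if "x \<in> carrier (isotropy_group G e)" for x
    using that by (intro bexI[of _ "ginv G x"]) (auto simp: isotropy_group_def isotropy_def groupoid_simps)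
qed (use assms in \<open>auto simp: isotropy_group_def isotropy_def groupoid_simps identities_unit\<close>)

lemma abelian_iff:
  "abelian_groupoid G \<longleftrightarrow>
    (\<forall>e \<in> identities G. \<forall>x \<in> isotropy G e. \<forall>y \<in> isotropy G e. x \<cdot> y = y \<cdot> x)"
proof -
  have "comm_group (isotropy_group G e) \<longleftrightarrow>
      (\<forall>x \<in> isotropy G e. \<forall>y \<in> isotropy G e. x \<cdot> y = y \<cdot> x)" if "e \<in> identities G" for e
  proof
    assume "comm_group (isotropy_group G e)"
    then interpret comm_group "isotropy_group G e" .
    show "\<forall>x \<in> isotropy G e. \<forall>y \<in> isotropy G e. x \<cdot> y = y \<cdot> x"
      using m_comm by (simp add: isotropy_group_def)
  next
    assume "\<forall>x \<in> isotropy G e. \<forall>y \<in> isotropy G e. x \<cdot> y = y \<cdot> x"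
    then show "comm_group (isotropy_group G e)"
      by (intro group.group_comm_groupI[OF group_isotropy[OF that]]) (simp add: isotropy_group_def)
  qed
  then show ?thesis using groupoid_axioms by (simp add: abelian_groupoid_def)
qed

section \<open>The groupoid of partial isomorphisms\<close>

text \<open>Together with \<open>partial_isosE\<close> this replaces the encoding by a restricted
  total function with intrinsic data: the domain, bijectivity and multiplicativity.\<close>

lemma partial_isosI:
  assumes "e \<in> identities G" "e' \<in> identities G" "dom f = isotropy G e"
    and "bij_betw (the \<circ> f) (isotropy G e) (isotropy G e')"
    and "\<And>x y. \<lbrakk>x \<in> isotropy G e; y \<in> isotropy G e\<rbrakk> \<Longrightarrow> the (f (x \<cdot> y)) = the (f x) \<cdot> the (f y)"
  shows "f \<in> partial_isos G"
proof -
  have "the \<circ> f \<in> iso (isotropy_group G e) (isotropy_group G e')"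
    using assms(4,5) by (auto simp: iso_def hom_def isotropy_group_def bij_betw_def)
  moreover have "f = (\<lambda>x. if x \<in> isotropy G e then Some ((the \<circ> f) x) else None)"
    using domIff[of _ f] by (auto simp: fun_eq_iff assms(3))
  ultimately show ?thesis unfolding partial_isos_def using assms(1,2) by blast
qed

lemma partial_isosE:
  assumes "f \<in> partial_isos G"
  obtains e e' where "e \<in> identities G" "e' \<in> identities G" "dom f = isotropy G e"
    "ran f = isotropy G e'" "bij_betw (the \<circ> f) (isotropy G e) (isotropy G e')"
    "\<And>x y. \<lbrakk>x \<in> isotropy G e; y \<in> isotropy G e\<rbrakk> \<Longrightarrow> the (f (x \<cdot> y)) = the (f x) \<cdot> the (f y)"
proof -
  obtain e e' k where f: "f = (\<lambda>x. if x \<in> isotropy G e then Some (k x) else None)"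
    "e \<in> identities G" "e' \<in> identities G" "k \<in> iso (isotropy_group G e) (isotropy_group G e')"
    using assms by (auto simp: partial_isos_def)
  have k: "bij_betw k (isotropy G e) (isotropy G e')"
    "\<And>x y. \<lbrakk>x \<in> isotropy G e; y \<in> isotropy G e\<rbrakk> \<Longrightarrow> k (x \<cdot> y) = k x \<cdot> k y"
    using f(4) by (auto simp: iso_def hom_def isotropy_group_def)
  have "bij_betw (the \<circ> f) (isotropy G e) (isotropy G e')"
    using k(1) by (rule bij_betw_cong[THEN iffD1, rotated]) (simp add: f(1))
  moreover have "dom f = isotropy G e" by (auto simp: f(1) split: if_splits)
  moreover have "ran f = k ` isotropy G e" by (auto simp: f(1) ran_def image_def)
  then have "ran f = isotropy G e'" using k(1) by (simp add: bij_betw_def)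
  ultimately show ?thesis
    using that f(2,3) k(2) isotropy_gprod by (simp add: f(1))
qed

lemma partial_isos_dom_ran:
  "f \<in> partial_isos G \<Longrightarrow> \<exists>e \<in> identities G. dom f = isotropy G e"
  "f \<in> partial_isos G \<Longrightarrow> \<exists>e \<in> identities G. ran f = isotropy G e"
  by (erule partial_isosE, blast)+

lemma partial_isos_id:
  assumes "e \<in> identities G"
  shows "Some |` isotropy G e \<in> partial_isos G"
proof (rule partial_isosI[OF assms assms])
  show "bij_betw (the \<circ> Some |` isotropy G e) (isotropy G e) (isotropy G e)"
    by (rule bij_betw_cong[THEN iffD1, OF _ bij_betw_id]) simp
qed (auto simp: isotropy_gprod split: if_splits)

lemma dom_map_comp: "ran k \<subseteq> dom f \<Longrightarrow> dom (f \<circ>\<^sub>m k) = dom k"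
  by (auto simp: map_comp_def dom_def ran_def split: option.splits)

lemma ran_map_comp: "ran k = dom f \<Longrightarrow> ran (f \<circ>\<^sub>m k) = ran f"
  by (fastforce simp: map_comp_def dom_def ran_def split: option.splits)

lemma partial_isos_comp:
  assumes f: "f \<in> partial_isos G" and k: "k \<in> partial_isos G" and fk: "dom f = ran k"
  shows "f \<circ>\<^sub>m k \<in> partial_isos G"
proof -
  obtain a b where f': "a \<in> identities G" "b \<in> identities G" "dom f = isotropy G a"
    "bij_betw (the \<circ> f) (isotropy G a) (isotropy G b)"
    "\<And>x y. \<lbrakk>x \<in> isotropy G a; y \<in> isotropy G a\<rbrakk> \<Longrightarrow> the (f (x \<cdot> y)) = the (f x) \<cdot> the (f y)"
    using f by (auto elim: partial_isosE)
  obtain c d where k': "c \<in> identities G" "dom k = isotropy G c" "ran k = isotropy G d"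
    "bij_betw (the \<circ> k) (isotropy G c) (isotropy G d)"
    "\<And>x y. \<lbrakk>x \<in> isotropy G c; y \<in> isotropy G c\<rbrakk> \<Longrightarrow> the (k (x \<cdot> y)) = the (k x) \<cdot> the (k y)"
    using k by (auto elim: partial_isosE)
  \<comment> \<open>The maps meet in one isotropy set, which determines its identity.\<close>
  have da: "d = a" using fk f'(3) k'(3) isotropy_eq_iff[OF f'(1)] by simp
  have kx: "k x = Some (the (k x))" "the (k x) \<in> isotropy G a" if "x \<in> isotropy G c" for x
    using that k'(2,4) by (force simp: da bij_betw_def domIff)+
  have fkx: "the ((f \<circ>\<^sub>m k) x) = the (f (the (k x)))" if "x \<in> isotropy G c" for x
    using kx(1)[OF that] by (metis map_comp_simps(2))
  show ?thesis
  proof (rule partial_isosI[OF k'(1) f'(2)])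
    show "dom (f \<circ>\<^sub>m k) = isotropy G c" using fk k'(2) by (simp add: dom_map_comp)
    have "bij_betw ((the \<circ> f) \<circ> (the \<circ> k)) (isotropy G c) (isotropy G b)"
      using bij_betw_trans k'(4) f'(4) da by blast
    then show "bij_betw (the \<circ> (f \<circ>\<^sub>m k)) (isotropy G c) (isotropy G b)"
      by (rule bij_betw_cong[THEN iffD1, rotated]) (simp add: fkx)
    show "the ((f \<circ>\<^sub>m k) (x \<cdot> y)) = the ((f \<circ>\<^sub>m k) x) \<cdot> the ((f \<circ>\<^sub>m k) y)"
      if "x \<in> isotropy G c" "y \<in> isotropy G c" for x y
      using that f'(5) k'(5) kx(2) by (simp add: fkx isotropy_gprod)
  qed
qed

lemma partial_isos_inverse:
  assumes f: "f \<in> partial_isos G"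
  obtains k where "k \<in> partial_isos G" "dom k = ran f" "ran k = dom f"
    "k \<circ>\<^sub>m f = Some |` dom f" "f \<circ>\<^sub>m k = Some |` ran f"
proof -
  obtain a b where f': "a \<in> identities G" "b \<in> identities G" "dom f = isotropy G a"
    "ran f = isotropy G b" "bij_betw (the \<circ> f) (isotropy G a) (isotropy G b)"
    "\<And>x y. \<lbrakk>x \<in> isotropy G a; y \<in> isotropy G a\<rbrakk> \<Longrightarrow> the (f (x \<cdot> y)) = the (f x) \<cdot> the (f y)"
    by (rule partial_isosE[OF f]) (rule that; simp)
  \<comment> \<open>The inverse function, whose values off \<open>isotropy G b\<close> are
    arbitrary; \<open>k\<close> cuts them away.\<close>
  define j where "j = inv_into (isotropy G a) (the \<circ> f)"
  define k where "k = (\<lambda>x. if x \<in> isotropy G b then Some (j x) else None)"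
  have jb: "bij_betw j (isotropy G b) (isotropy G a)"
    unfolding j_def by (rule bij_betw_inv_into[OF f'(5)])
  have jf: "j (the (f x)) = x" if "x \<in> isotropy G a" for x
    using bij_betw_inv_into_left[OF f'(5) that] by (simp add: j_def)
  have fj: "the (f (j x)) = x" if "x \<in> isotropy G b" for x
    using bij_betw_inv_into_right[OF f'(5) that] by (simp add: j_def)
  have ja: "j x \<in> isotropy G a" if "x \<in> isotropy G b" for x
    using jb that by (auto simp: bij_betw_def)
  have fSome: "f x = Some (the (f x))" "the (f x) \<in> isotropy G b" if "x \<in> isotropy G a" for x
    using f'(3,5) that by (force simp: domIff bij_betw_def)+
  have fNone: "f x = None" if "x \<notin> isotropy G a" for x
    using f'(3) that by auto
  show ?thesis
  proof (rule that[of k])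
    show dk: "dom k = ran f" by (auto simp: f'(4) k_def split: if_splits)
    have "ran k = j ` isotropy G b" by (auto simp: k_def ran_def image_def)
    then show "ran k = dom f" using jb by (simp add: f'(3) bij_betw_def)
    show "k \<in> partial_isos G"
    proof (rule partial_isosI[OF f'(2,1)])
      show "dom k = isotropy G b" using dk f'(4) by simp
      show "bij_betw (the \<circ> k) (isotropy G b) (isotropy G a)"
        using jb by (rule bij_betw_cong[THEN iffD1, rotated]) (simp add: k_def)
      fix x y assume xy: "x \<in> isotropy G b" "y \<in> isotropy G b"
      \<comment> \<open>Multiplicativity of the inverse: insert \<open>j\<close> after
        \<open>f\<close>, then use that \<open>f\<close> is multiplicative and undoes
        \<open>j\<close>.\<close>
      have "j x \<cdot> j y = j (the (f (j x \<cdot> j y)))"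
        using xy by (simp add: jf ja isotropy_gprod)
      also have "\<dots> = j (x \<cdot> y)" using xy by (simp add: f'(6) ja fj)
      finally show "the (k (x \<cdot> y)) = the (k x) \<cdot> the (k y)"
        using xy by (simp add: k_def isotropy_gprod)
    qed
    show "k \<circ>\<^sub>m f = Some |` dom f"
    proof
      fix x show "(k \<circ>\<^sub>m f) x = (Some |` dom f) x"
      proof (cases "x \<in> isotropy G a")
        case True
        then have "(k \<circ>\<^sub>m f) x = k (the (f x))" using fSome by (metis map_comp_simps(2))
        then show ?thesis using True fSome(2) by (simp add: k_def jf f'(3))
      qed (simp add: fNone f'(3))
    qed
    show "f \<circ>\<^sub>m k = Some |` ran f"
    proof
      fix x show "(f \<circ>\<^sub>m k) x = (Some |` ran f) x"
      proof (cases "x \<in> isotropy G b")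
        case True
        then have "(f \<circ>\<^sub>m k) x = f (j x)" by (simp add: k_def map_comp_def)
        then show ?thesis using True fSome(1)[OF ja[OF True]] by (simp add: fj f'(4))
      qed (simp add: k_def map_comp_def f'(4))
    qed
  qed
qed

lemma partial_iso_groupoid_simps:
  "carrier (partial_iso_groupoid G) = partial_isos G"
  "composable (partial_iso_groupoid G) f k \<longleftrightarrow>
    f \<in> partial_isos G \<and> k \<in> partial_isos G \<and> dom f = ran k"
  "\<lbrakk>f \<in> partial_isos G; k \<in> partial_isos G; dom f = ran k\<rbrakk>
    \<Longrightarrow> f \<cdot>\<^bsub>partial_iso_groupoid G\<^esub> k = f \<circ>\<^sub>m k"
  by (auto simp: partial_iso_groupoid_def composable_def gprod_def)

lemma map_comp_id: "f \<circ>\<^sub>m (Some |` dom f) = f" "(Some |` ran f) \<circ>\<^sub>m f = f"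
  by (auto simp: fun_eq_iff map_comp_def restrict_map_def ran_def dom_def split: option.splits)

lemma dom_ran_id: "dom (Some |` A) = A" "ran (Some |` A) = A"
  by (auto simp: restrict_map_def dom_def ran_def split: if_splits)

lemma partial_isos_unit:
  assumes "f \<in> partial_isos G"
  shows "Some |` dom f \<in> partial_isos G" "Some |` ran f \<in> partial_isos G"
  using partial_isos_dom_ran[OF assms] partial_isos_id by auto

lemma map_comp_assoc: "f \<circ>\<^sub>m (g \<circ>\<^sub>m h) = (f \<circ>\<^sub>m g) \<circ>\<^sub>m h"
  by (auto simp: fun_eq_iff map_comp_def split: option.splits)

text \<open>Here the objects are the isotropy sets themselves, and the morphism \<open>u A\<close>
  is the partial identity on \<open>A\<close>.\<close>

lemma groupoid_partial_isos: "groupoid (partial_iso_groupoid G)"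
proof (rule groupoidI[where D = dom and R = ran and u = "\<lambda>A. Some |` A"])
  fix f assume "f \<in> carrier (partial_iso_groupoid G)"
  then have f: "f \<in> partial_isos G" by (simp add: partial_iso_groupoid_simps)
  then obtain k where "k \<in> partial_isos G" "dom k = ran f" "ran k = dom f"
    "k \<circ>\<^sub>m f = Some |` dom f" "f \<circ>\<^sub>m k = Some |` ran f" by (rule partial_isos_inverse)
  then show "\<exists>k\<in>carrier (partial_iso_groupoid G). dom k = ran f \<and> ran k = dom f \<and>
      k \<cdot>\<^bsub>partial_iso_groupoid G\<^esub> f = Some |` dom f \<and> f \<cdot>\<^bsub>partial_iso_groupoid G\<^esub> k = Some |` ran f"
    using f by (intro bexI[of _ k]) (simp_all add: partial_iso_groupoid_simps)
qed (simp_all add: partial_iso_groupoid_simps partial_isos_comp partial_isos_unit dom_map_comp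
    ran_map_comp map_comp_id dom_ran_id map_comp_assoc)

lemma gdom_gran_partial_isos:
  assumes "f \<in> partial_isos G"
  shows "gdom (partial_iso_groupoid G) f = Some |` dom f"
    "gran (partial_iso_groupoid G) f = Some |` ran f"
proof -
  interpret A: groupoid "partial_iso_groupoid G" by (rule groupoid_partial_isos)
  show "gdom (partial_iso_groupoid G) f = Some |` dom f"
    "gran (partial_iso_groupoid G) f = Some |` ran f"
    using assms by (auto intro!: A.gdom_eqI A.gran_eqI
      simp: partial_iso_groupoid_simps partial_isos_unit dom_ran_id map_comp_id)
qed

section \<open>Partial inner isomorphisms\<close>

lemma inner_map_Some:
  "x \<in> isotropy G (gdom G g) \<Longrightarrow> inner_map G g x = Some (g \<cdot> x \<cdot> ginv G g)"
  by (simp add: inner_map_def)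

lemma dom_inner_map: "dom (inner_map G g) = isotropy G (gdom G g)"
  by (auto simp: inner_map_def split: if_splits)

lemma conj_isotropy:
  assumes "g \<in> carrier G" "x \<in> isotropy G (gdom G g)"
  shows "g \<cdot> x \<cdot> ginv G g \<in> isotropy G (gran G g)"
  using assms by (simp add: isotropy_def groupoid_simps)

lemma ginv_conj:
  assumes "g \<in> carrier G" "x \<in> isotropy G (gdom G g)"
  shows "ginv G g \<cdot> (g \<cdot> x \<cdot> ginv G g) \<cdot> g = x"
  using assms by (simp add: isotropy_def groupoid_simps)

lemma inner_map_bij:
  assumes g: "g \<in> carrier G"
  shows "bij_betw (the \<circ> inner_map G g) (isotropy G (gdom G g)) (isotropy G (gran G g))"
\<comment> \<open>The inverse of conjugation by \<open>g\<close> is conjugation by its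
  inverse.\<close>
proof (rule bij_betw_byWitness[where f' = "\<lambda>y. ginv G g \<cdot> y \<cdot> g"])
  show "\<forall>y\<in>isotropy G (gran G g). (the \<circ> inner_map G g) (ginv G g \<cdot> y \<cdot> g) = y"
    using g by (auto simp: inner_map_def isotropy_def groupoid_simps)
  show "(\<lambda>y. ginv G g \<cdot> y \<cdot> g) ` isotropy G (gran G g) \<subseteq> isotropy G (gdom G g)"
    using g by (auto simp: isotropy_def groupoid_simps)
qed (use g in \<open>auto simp: inner_map_Some ginv_conj conj_isotropy\<close>)

lemma ran_inner_map:
  assumes "g \<in> carrier G"
  shows "ran (inner_map G g) = isotropy G (gran G g)"
proof -
  have "ran (inner_map G g) = (the \<circ> inner_map G g) ` dom (inner_map G g)"
    by (force simp: ran_def dom_def image_def)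
  then show ?thesis using inner_map_bij[OF assms] by (simp add: dom_inner_map bij_betw_def)
qed

lemma inner_map_partial_iso:
  assumes g: "g \<in> carrier G"
  shows "inner_map G g \<in> partial_isos G"
proof (rule partial_isosI[OF gdom_identities[OF g] gran_identities[OF g] dom_inner_map inner_map_bij[OF g]])
  fix x y assume "x \<in> isotropy G (gdom G g)" "y \<in> isotropy G (gdom G g)"
  then show "the (inner_map G g (x \<cdot> y)) = the (inner_map G g x) \<cdot> the (inner_map G g y)"
    using g by (simp add: inner_map_def isotropy_def groupoid_simps)
qed

lemma inner_map_gprod:
  assumes "g \<in> carrier G" "h \<in> carrier G" "gdom G g = gran G h"
  shows "inner_map G (g \<cdot> h) = inner_map G g \<circ>\<^sub>m inner_map G h"
  using assms by (auto simp: fun_eq_iff inner_map_def map_comp_def isotropy_def groupoid_simps)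

lemma inner_map_unit: "e \<in> identities G \<Longrightarrow> inner_map G e = Some |` isotropy G e"
  by (auto simp: fun_eq_iff inner_map_def restrict_map_def isotropy_def identities_unit ginv_unit groupoid_simps)

text \<open>Composability of two inner maps equates the isotropy sets at \<open>gdom G g\<close> and
  \<open>gran G h\<close>; \<open>isotropy_eq_iff\<close> then equates these identities, which is
  strength.\<close>

lemma inner_map_strong_hom: "strong_groupoid_hom G (partial_iso_groupoid G) (inner_map G)"
  using groupoid_axioms groupoid_partial_isos
  by (auto simp: strong_groupoid_hom_def groupoid_hom_def partial_iso_groupoid_simps
      inner_map_partial_iso composable_iff dom_inner_map ran_inner_map inner_map_gprod
      isotropy_eq_iff gdom_identities)

lemma inner_map_eqD:
  assumes "g \<in> carrier G" "l \<in> carrier G" "inner_map G g = inner_map G l"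
  shows "gdom G g = gdom G l" "gran G g = gran G l"
  using assms dom_inner_map[of g] dom_inner_map[of l] ran_inner_map[of g] ran_inner_map[of l]
    isotropy_eq_iff gdom_identities gran_identities by metis+

text \<open>Multiplying by \<open>g\<close> or its inverse on the right exchanges
  \<open>g x = x g\<close> with the statement that conjugation by \<open>g\<close> fixes
  \<open>x\<close>. Both the abelian criterion and the description of the center rest on
  this.\<close>

lemma inner_map_trivial_iff:
  assumes "g \<in> isotropy G e"
  shows "inner_map G g = inner_map G e \<longleftrightarrow> (\<forall>x \<in> isotropy G e. g \<cdot> x = x \<cdot> g)"
proof -
  note g = isotropy_simps[OF assms]
  have e: "e \<in> identities G" using gdom_identities[OF g(1)] g by simp
  have "g \<cdot> x \<cdot> ginv G g = x \<longleftrightarrow> g \<cdot> x = x \<cdot> g" if x: "x \<in> isotropy G e" for x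
  proof
    note x' = isotropy_simps[OF x]
    assume "g \<cdot> x \<cdot> ginv G g = x"
    then have "g \<cdot> x \<cdot> ginv G g \<cdot> g = x \<cdot> g" by simp
    then show "g \<cdot> x = x \<cdot> g" using g x' by (simp add: groupoid_simps)
  next
    note x' = isotropy_simps[OF x]
    assume "g \<cdot> x = x \<cdot> g"
    then have "g \<cdot> x \<cdot> ginv G g = x \<cdot> g \<cdot> ginv G g" by simp
    also have "\<dots> = x" using g x' by (simp add: groupoid_simps)
    finally show "g \<cdot> x \<cdot> ginv G g = x" .
  qed
  moreover have "inner_map G g = Some |` isotropy G e \<longleftrightarrow>
      (\<forall>x \<in> isotropy G e. g \<cdot> x \<cdot> ginv G g = x)"
    by (auto simp: fun_eq_iff inner_map_def restrict_map_def g(2))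
  ultimately show ?thesis by (simp add: inner_map_unit[OF e])
qed

section \<open>Abelian groupoids, the center and its cosets\<close>

lemma Iso_iff: "g \<in> Iso G \<longleftrightarrow> g \<in> carrier G \<and> gdom G g = gran G g"
  using gdom_identities by (auto simp: Iso_def isotropy_def)

lemma abelian_iff_inner_Iso:
  "inner_map G ` Iso G = inner_map G ` identities G \<longleftrightarrow> abelian_groupoid G"
proof
  assume eq: "inner_map G ` Iso G = inner_map G ` identities G"
  have "g \<cdot> x = x \<cdot> g" if e: "e \<in> identities G" and g: "g \<in> isotropy G e" and x: "x \<in> isotropy G e" for e g x
  proof -
    note g' = isotropy_simps[OF g]
    have "g \<in> Iso G" using e g by (auto simp: Iso_def)
    then obtain a where a: "a \<in> identities G" "inner_map G g = inner_map G a" using eq by blast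
    have "a = e" using inner_map_eqD(1)[OF g'(1) identities_unit(1)[OF a(1)] a(2)] g'
      identities_unit[OF a(1)] by simp
    then show ?thesis using a inner_map_trivial_iff[OF g] x by blast
  qed
  then show "abelian_groupoid G" by (auto simp: abelian_iff)
next
  assume "abelian_groupoid G"
  then have "inner_map G g = inner_map G e" if "e \<in> identities G" "g \<in> isotropy G e" for e g
    using that inner_map_trivial_iff[OF that(2)] unfolding abelian_iff by blast
  then show "inner_map G ` Iso G = inner_map G ` identities G"
    using unit_in_isotropy unfolding Iso_def image_def by blast
qed

text \<open>Equality of the two maps already puts \<open>z\<close> into \<open>Iso G\<close>: their
  ranges are the isotropy groups at \<open>gran G z\<close> and \<open>gdom G z\<close>. The rest is
  \<open>inner_map_trivial_iff\<close>.\<close>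

lemma gcenter_iff:
  "z \<in> gcenter G \<longleftrightarrow> z \<in> carrier G \<and> inner_map G z = inner_map G (gdom G z)"
proof -
  have "gdom G z = gran G z" if "z \<in> carrier G" "inner_map G z = inner_map G (gdom G z)"
    using inner_map_eqD(2)[OF that(1) gdom_right(1)[OF that(1)] that(2)] that
    by (simp add: groupoid_simps)
  moreover have "z \<in> gcenter G \<longleftrightarrow> inner_map G z = inner_map G (gdom G z)"
    if z: "z \<in> carrier G" "gdom G z = gran G z"
    using inner_map_trivial_iff[of z "gdom G z"] z
    by (auto simp: gcenter_def Iso_iff isotropy_def)
  moreover have "z \<in> carrier G \<and> gdom G z = gran G z" if "z \<in> gcenter G"
    using that by (simp add: gcenter_def Iso_iff)
  ultimately show ?thesis by blast
qed

text \<open>A central factor on the right contributes an identity map; conversely, two elements with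
  the same inner map differ by an element with trivial inner map.\<close>

lemma left_coset_gcenter:
  assumes g: "g \<in> carrier G"
  shows "left_coset G (gcenter G) g = {x \<in> carrier G. inner_map G x = inner_map G g}"
proof (intro equalityI subsetI)
  fix x assume "x \<in> left_coset G (gcenter G) g"
  then obtain z where z: "x = g \<cdot> z" "z \<in> carrier G" "inner_map G z = inner_map G (gdom G z)"
    "gran G z = gdom G g"
    by (auto simp: left_coset_def gcenter_iff)
  have dz: "gdom G z = gdom G g"
    using inner_map_eqD(2)[OF z(2) gdom_right(1)[OF z(2)] z(3)] z(2,4) by (simp add: groupoid_simps)
  have "inner_map G x = inner_map G g \<circ>\<^sub>m inner_map G (gdom G g)"
    using g z dz by (simp add: inner_map_gprod)
  also have "\<dots> = inner_map G (g \<cdot> gdom G g)"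
    using g by (intro inner_map_gprod[symmetric]) (simp_all add: groupoid_simps)
  finally show "x \<in> {x \<in> carrier G. inner_map G x = inner_map G g}"
    using g z by (simp add: groupoid_simps)
next
  fix x assume "x \<in> {x \<in> carrier G. inner_map G x = inner_map G g}"
  then have x: "x \<in> carrier G" "inner_map G x = inner_map G g" by auto
  note dr = inner_map_eqD[OF x(1) g x(2)]
  \<comment> \<open>The only candidate for the central factor: \<open>x = g z\<close> forces
    it.\<close>
  let ?z = "ginv G g \<cdot> x"
  have "inner_map G ?z = inner_map G (ginv G g) \<circ>\<^sub>m inner_map G g"
    using g x dr by (simp add: inner_map_gprod groupoid_simps)
  also have "\<dots> = inner_map G (ginv G g \<cdot> g)"
    using g by (intro inner_map_gprod[symmetric]) (simp_all add: groupoid_simps)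
  finally have "?z \<in> gcenter G" using g x dr by (simp add: gcenter_iff groupoid_simps)
  moreover have "x = g \<cdot> ?z" "gran G ?z = gdom G g" using g x dr by (simp_all add: groupoid_simps)
  ultimately show "x \<in> left_coset G (gcenter G) g" unfolding left_coset_def by blast
qed

lemma left_coset_gcenter_eq_iff:
  assumes "x \<in> carrier G" "y \<in> carrier G"
  shows "left_coset G (gcenter G) x = left_coset G (gcenter G) y \<longleftrightarrow> inner_map G x = inner_map G y"
  using assms by (auto simp: left_coset_gcenter)

section \<open>Normality of the partial inner isomorphisms\<close>

lemma identities_partial_isos:
  "identities (partial_iso_groupoid G) = inner_map G ` identities G"
proof -
  interpret A: groupoid "partial_iso_groupoid G" by (rule groupoid_partial_isos)
  show ?thesis
  proof (intro equalityI subsetI)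
    fix f assume "f \<in> identities (partial_iso_groupoid G)"
    then have f: "f \<in> partial_isos G" "f = Some |` dom f"
      using A.identities_unit gdom_gran_partial_isos by (metis partial_iso_groupoid_simps(1))+
    then show "f \<in> inner_map G ` identities G"
      using partial_isos_dom_ran(1)[OF f(1)] inner_map_unit by force
  next
    fix f assume "f \<in> inner_map G ` identities G"
    then obtain e where e: "e \<in> identities G" "f = Some |` isotropy G e"
      by (auto simp: inner_map_unit)
    then show "f \<in> identities (partial_iso_groupoid G)"
      using partial_isos_id[OF e(1)]
      by (simp add: A.identities_iff partial_iso_groupoid_simps gdom_gran_partial_isos dom_ran_id)
  qed
qed

text \<open>An isomorphism carries conjugation by \<open>k\<close> to conjugation by
  \<open>f(k)\<close>. Stated without the inverse of \<open>f\<close>, this says that conjugating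
  \<open>inner_map G g\<close> by \<open>f\<close> gives the inner map of the preimage of
  \<open>g\<close>.\<close>

lemma inner_map_conj:
  assumes f: "f \<in> partial_isos G" and k: "f k = Some g" and fg: "dom (inner_map G g) = ran f"
  shows "inner_map G g \<circ>\<^sub>m f = f \<circ>\<^sub>m inner_map G k"
proof -
  obtain a b where f': "a \<in> identities G" "b \<in> identities G" "dom f = isotropy G a"
    "ran f = isotropy G b" "bij_betw (the \<circ> f) (isotropy G a) (isotropy G b)"
    "\<And>x y. \<lbrakk>x \<in> isotropy G a; y \<in> isotropy G a\<rbrakk> \<Longrightarrow> the (f (x \<cdot> y)) = the (f x) \<cdot> the (f y)"
    by (rule partial_isosE[OF f]) (rule that; simp)
  have ka: "k \<in> isotropy G a" using k f'(3) by auto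
  note k' = isotropy_simps[OF ka]
  have gb: "g \<in> isotropy G b" using k f'(4) by (auto simp: ran_def)
  note g' = isotropy_simps[OF gb]
  have fx: "f x = Some (the (f x))" "the (f x) \<in> isotropy G b" if "x \<in> isotropy G a" for x
    using f'(3,5) that by (force simp: domIff bij_betw_def)+
  have ik: "ginv G k \<in> isotropy G a" using k' by (simp add: isotropy_def groupoid_simps)
  \<comment> \<open>The conjugation formula multiplied by \<open>g\<close> on the right: the inverse
    of \<open>k\<close> cancels inside the argument of \<open>f\<close>, so multiplicativity of
    \<open>f\<close> suffices.\<close>
  have comm: "the (f (k \<cdot> x \<cdot> ginv G k)) \<cdot> g = g \<cdot> the (f x)" if x: "x \<in> isotropy G a" for x
  proof -
    note x' = isotropy_simps[OF x]
    have "the (f (k \<cdot> x \<cdot> ginv G k)) \<cdot> the (f k) = the (f (k \<cdot> x \<cdot> ginv G k \<cdot> k))"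
      using f'(6) ka ik x isotropy_gprod by metis
    also have "\<dots> = the (f (k \<cdot> x))" using k' x' by (simp add: groupoid_simps)
    also have "\<dots> = g \<cdot> the (f x)" using f'(6)[OF ka x] k by simp
    finally show ?thesis using k by simp
  qed
  have conj: "f (k \<cdot> x \<cdot> ginv G k) = Some (g \<cdot> the (f x) \<cdot> ginv G g)" if x: "x \<in> isotropy G a" for x
  proof -
    have y: "k \<cdot> x \<cdot> ginv G k \<in> isotropy G a" using ka x ik isotropy_gprod by blast
    have "the (f (k \<cdot> x \<cdot> ginv G k)) \<cdot> g \<cdot> ginv G g = g \<cdot> the (f x) \<cdot> ginv G g"
      by (simp only: comm[OF x])
    then have "the (f (k \<cdot> x \<cdot> ginv G k)) = g \<cdot> the (f x) \<cdot> ginv G g"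
      using isotropy_simps[OF fx(2)[OF y]] g' by (simp add: groupoid_simps)
    then show ?thesis using fx(1)[OF y] by simp
  qed
  show ?thesis
  proof
    fix x show "(inner_map G g \<circ>\<^sub>m f) x = (f \<circ>\<^sub>m inner_map G k) x"
    proof (cases "x \<in> isotropy G a")
      case True
      have "(inner_map G g \<circ>\<^sub>m f) x = inner_map G g (the (f x))"
        using fx(1)[OF True] by (metis map_comp_simps(2))
      then show ?thesis
        using True fx(2)[OF True] g' k' conj[OF True] by (simp add: inner_map_def map_comp_def)
    next
      case False
      then have "f x = None" using f'(3) by auto
      then show ?thesis using False k' by (simp add: inner_map_def map_comp_def)
    qed
  qed
qed

lemma normal_inner_maps:
  assumes "carrier G \<noteq> {}"
  shows "normal_subgroupoid (inner_maps G) (partial_iso_groupoid G)"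
proof -
  let ?A = "partial_iso_groupoid G"
  interpret A: groupoid ?A by (rule groupoid_partial_isos)
  \<comment> \<open>The image of a strong homomorphism is a subgroupoid, and each identity of
    \<open>?A\<close> is the inner map of an identity of \<open>G\<close>.\<close>
  have "wide_subgroupoid (inner_maps G) ?A"
    using subgroupoid_strong_image[OF inner_map_strong_hom assms] identities_unit(1)
    by (auto simp: A.wide_subgroupoid_iff inner_maps_def identities_partial_isos)
  moreover have "conj_set ?A (inner_maps G) f \<subseteq> inner_maps G" if "f \<in> carrier ?A" for f
  proof
    fix c assume "c \<in> conj_set ?A (inner_maps G) f"
    then obtain g where g: "g \<in> carrier G" "gran ?A (inner_map G g) = gdom ?A (inner_map G g)"
      "gdom ?A (inner_map G g) = gran ?A f" and c: "c = ginv ?A f \<cdot>\<^bsub>?A\<^esub> inner_map G g \<cdot>\<^bsub>?A\<^esub> f"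
      by (auto simp: conj_set_def inner_maps_def)
    have f: "f \<in> partial_isos G" using that by (simp add: partial_iso_groupoid_simps)
    note I = inner_map_partial_iso
    have dr: "ran (inner_map G g) = dom (inner_map G g)" "dom (inner_map G g) = ran f"
      using g(2,3) f I[OF g(1)] by (metis gdom_gran_partial_isos dom_ran_id(1))+
    have dg: "gran G g = gdom G g"
      using dr(1) isotropy_eq_iff[OF gran_identities[OF g(1)]] g(1) by (simp add: dom_inner_map ran_inner_map)
    \<comment> \<open>Conjugating by \<open>f\<close> requires the inner map to have equal domain
      and range, so \<open>g\<close> is an isotropy element in the range of \<open>f\<close> and has
      a preimage \<open>k\<close>.\<close>
    have "g \<in> dom (inner_map G g)" using g(1) dg by (simp add: dom_inner_map isotropy_def)
    then obtain k where k: "f k = Some g" using dr(2) by (auto simp: ran_def)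
    obtain a where a: "dom f = isotropy G a" using partial_isos_dom_ran(1)[OF f] by blast
    then have "k \<in> isotropy G a" using k by auto
    note k' = isotropy_simps[OF this]
    have fk: "dom f = ran (inner_map G k)" using a k' by (simp add: ran_inner_map)
    \<comment> \<open>After rebracketing, \<open>f\<close> moves to the left past the inner map,
      which becomes that of \<open>k\<close>, and cancels against its inverse.\<close>
    have "c = ginv ?A f \<cdot>\<^bsub>?A\<^esub> (inner_map G g \<cdot>\<^bsub>?A\<^esub> f)"
      unfolding c using that g I[OF g(1)]
      by (intro A.gprod_assoc A.ginv_inverse(1)) (simp_all add: A.gdom_ginv partial_iso_groupoid_simps)
    also have "inner_map G g \<cdot>\<^bsub>?A\<^esub> f = f \<cdot>\<^bsub>?A\<^esub> inner_map G k"
      using inner_map_conj[OF f k dr(2)] dr fk f I g(1) k'(1) by (simp add: partial_iso_groupoid_simps)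
    also have "ginv ?A f \<cdot>\<^bsub>?A\<^esub> (f \<cdot>\<^bsub>?A\<^esub> inner_map G k) = inner_map G k"
      using f I[OF k'(1)] fk
      by (intro A.ginv_cancel_left) (simp_all add: partial_iso_groupoid_simps gdom_gran_partial_isos)
    finally show "c \<in> inner_maps G" using k'(1) by (simp add: inner_maps_def)
  qed
  ultimately show ?thesis by (simp add: normal_subgroupoid_def)
qed

text \<open>\<open>conj_set\<close> puts the inverse on the left while \<open>inner_map\<close> puts
  it on the right, hence the inverse in the index.\<close>

lemma conj_set_ginv:
  assumes "g \<in> carrier G" "H \<subseteq> carrier G"
  shows "conj_set G H (ginv G g) = (\<lambda>x. the (inner_map G g x)) ` (H \<inter> isotropy G (gdom G g))"
  using assms(1) subsetD[OF assms(2)]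
  by (force simp: conj_set_def inner_map_def isotropy_def groupoid_simps image_def)

lemma normal_iff_invariant:
  assumes "wide_subgroupoid H G"
  shows "normal_subgroupoid H G \<longleftrightarrow> (\<forall>g \<in> carrier G. invariant_under H (inner_map G g))"
proof -
  have sub: "H \<subseteq> carrier G" using assms by (simp add: wide_subgroupoid_def subgroupoid_def)
  let ?I = "\<lambda>g. (\<lambda>x. the (inner_map G g x)) ` (H \<inter> isotropy G (gdom G g))"
  have inv_iff: "invariant_under H (inner_map G g) \<longleftrightarrow> ?I g = H \<inter> isotropy G (gran G g)"
    if "g \<in> carrier G" for g
    using that by (simp add: invariant_under_def dom_inner_map ran_inner_map)
  show ?thesis
  proof
    assume N: "normal_subgroupoid H G"
    have I: "?I g \<subseteq> H" if "g \<in> carrier G" for g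
      using N that ginv_inverse(1)[OF that] conj_set_ginv[OF that sub]
      by (auto simp: normal_subgroupoid_def)
    have "?I g = H \<inter> isotropy G (gran G g)" if g: "g \<in> carrier G" for g
    proof (intro equalityI subsetI)
      fix y assume "y \<in> ?I g"
      then show "y \<in> H \<inter> isotropy G (gran G g)"
        using I[OF g] conj_isotropy[OF g] by (auto simp: inner_map_Some)
    next
      fix y assume y: "y \<in> H \<inter> isotropy G (gran G g)"
      \<comment> \<open>The preimage of \<open>y\<close> under \<open>inner_map G g\<close>; it is
        the value of the inner map of the inverse at \<open>y\<close>, so normality places it in
        \<open>H\<close>.\<close>
      let ?x = "ginv G g \<cdot> y \<cdot> g"
      have "the (inner_map G (ginv G g) y) \<in> ?I (ginv G g)"
        using y g by (simp add: groupoid_simps)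
      moreover have "the (inner_map G (ginv G g) y) = ?x"
        using y g by (simp add: inner_map_def groupoid_simps)
      ultimately have "?x \<in> H" using I[OF ginv_inverse(1)[OF g]] by auto
      moreover have "?x \<in> isotropy G (gdom G g)"
        using y g by (simp add: isotropy_def groupoid_simps)
      moreover have "the (inner_map G g ?x) = y"
        using y g by (simp add: inner_map_def isotropy_def groupoid_simps)
      ultimately show "y \<in> ?I g" by (metis (no_types, lifting) IntI imageI)
    qed
    then show "\<forall>g \<in> carrier G. invariant_under H (inner_map G g)" using inv_iff by blast
  next
    assume *: "\<forall>g \<in> carrier G. invariant_under H (inner_map G g)"
    \<comment> \<open>As \<open>g\<close> is the inverse of its inverse, this set is an image of
      part of \<open>H\<close> under the inner map of \<open>ginv G g\<close>, which invariance
      keeps in \<open>H\<close>.\<close>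
    have "conj_set G H g \<subseteq> H" if g: "g \<in> carrier G" for g
      using conj_set_ginv[OF ginv_inverse(1)[OF g] sub] * inv_iff[OF ginv_inverse(1)[OF g]]
        ginv_inverse(1)[OF g] ginv_ginv[OF g] by auto
    then show "normal_subgroupoid H G" using assms by (simp add: normal_subgroupoid_def)
  qed
qed

end

theorem proposition5p2:
  fixes G :: "'a groupoid" and H :: "'a set"
  assumes "groupoid G"
    and "wide_subgroupoid H G"
  shows "normal_subgroupoid (inner_maps G) (partial_iso_groupoid G) \<and>
    (inner_map G ` Iso G = inner_map G ` identities G \<longleftrightarrow> abelian_groupoid G) \<and>
    strong_groupoid_hom G (inner_groupoid G) (\<lambda>g. inner_map G g) \<and>
    isomorphic_groupoids (quotient_groupoid G (gcenter G)) (inner_groupoid G) \<and>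
    (normal_subgroupoid H G \<longleftrightarrow> (\<forall>g \<in> carrier G. invariant_under H (inner_map G g)))"
proof -
  interpret groupoid G by fact
  \<comment> \<open>The axioms admit an empty groupoid, but a subgroupoid is nonempty, so
    \<open>H\<close> provides an element.\<close>
  have ne: "carrier G \<noteq> {}"
    using assms(2) by (auto simp: wide_subgroupoid_def subgroupoid_def)
  have strong: "strong_groupoid_hom G (inner_groupoid G) (inner_map G)"
    unfolding inner_groupoid_def inner_maps_def
    by (rule strong_hom_induced[OF inner_map_strong_hom ne])
  have "isomorphic_groupoids (quotient_groupoid G (gcenter G)) (inner_groupoid G)"
    \<comment> \<open>The fibre condition is that cosets of the center coincide exactly when the
      inner maps do.\<close>
    by (rule isomorphic_quotient[OF strong])
      (simp_all add: inner_groupoid_def inner_maps_def induced_groupoid_simps left_coset_gcenter_eq_iff)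
  then show ?thesis
    using normal_inner_maps[OF ne] abelian_iff_inner_Iso strong normal_iff_invariant[OF assms(2)]
    by simp
qed

end
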